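(* If $V$ is a unitary module of an $I$-partial $*$-algebraic quantum group $(A,\Delta)$, then $A$ automatically acts by bounded operators on $V$, i.e. for each $a\in A$ the operator $v\mapsto av$ on the pre-Hilbert space $V$ is bounded.
   Context: Conventions. Algebras are associative over $\mathbb C$, not necessarily unital; for subspaces, $VW$ is the span of products. $M(A)$ is the multiplier algebra of $A$: pairs $m=(\lambda,\rho)$ of linear maps on $A$, written $ma=\lambda(a)$, $am=\rho(a)$, with $a(mb)=(am)b$; strict convergence $m_\alpha\to m$ means that for each $a\in A$ eventually $m_\alpha a=ma$ and $am_\alpha=am$. An algebra $B$ is left (right) non-degenerate if $bB=0$ (resp. $Bb=0$) implies $b=0$, non-degenerate if both, and idempotent if $BB=B$. Partial algebras. For a set $J$, a $J$-partial algebra is an algebra $A=\bigoplus_{r,s\in J}A(r,s)$ with $A(r,s)A(s',t)=0$ for $s\neq s'$ and $A(r,s)A(s,t)\subseteq A(r,t)$. Its base units $\mathbf 1(r)\in M(A)$ are given by $\mathbf 1(r)a=\delta_{r,r'}a$, $a\mathbf 1(s)=\delta_{s,s'}a$ for $a\in A(r',s')$. It is non-degenerate if all algebras $A\mathbf 1(r)$ are left non-degenerate and all $\mathbf 1(r)A$ are right non-degenerate; idempotent if all $A\mathbf 1(r)$ and $\mathbf 1(r)A$ are idempotent. A morphism $A\to B$ of non-degenerate idempotent $J$-partial algebras is a homomorphism $f:A\to M(B)$ with $B\mathbf 1(r)\cdot f(A\mathbf 1(r))=B\mathbf 1(r)$ and $f(\mathbf 1(r)A)\cdot\mathbf 1(r)B=\mathbf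 1(r)B$ for all $r$; it extends uniquely to a unital homomorphism $M(A)\to M(B)$. Partial multiplier Hopf algebras. Fix a set $I$. In an $I^2$-partial algebra ($J=I\times I$, indices written as columns) the base units are $\mathbf 1\binom rt$ and the components are ${}^r_tA^s_u=\mathbf 1\binom rtA\mathbf 1\binom su$. Put $\mathbf 1^r=\sum_t\mathbf 1\binom rt$, $\mathbf 1_t=\sum_r\mathbf 1\binom rt$ (strict sums in $M(A)$). Omitted indices are summed over: $A^s=A\mathbf 1^s$, $A_u=A\mathbf 1_u$, ${}^rA=\mathbf 1^rA$, ${}_tA=\mathbf 1_tA$, $A^s_u=A\mathbf 1\binom su$, etc. $A\otimes^IB=\bigoplus\,{}^r_tA^s_u\otimes{}^t_vB^u_w\subseteq A\otimes B$ is an $I^2$-partial algebra with ${}^r_v(A\otimes^IB)^s_w=\bigoplus_{t,u}{}^r_tA^s_u\otimes{}^t_vB^u_w$; it equals $E(A\otimes B)E$ with $E=\sum_t\mathbf 1_t\otimes\mathbf 1^t$, and one identifies $M(A\otimes^IB)=E\,M(A\otimes B)E$. For a non-degenerate idempotent $I^2$-partial algebra $A$, a regular comultiplication is a morphism $\Delta$ from $A$ to $A\otimes^IA$ such that $\Delta(a)(b\otimes1),\Delta(a)(1\otimes b),(b\otimes1)\Delta(a),(1\otimes b)\Delta(a)\in A\otimes A$ for all $a,b\in A$ and $(\Delta\otimes\mathrm{id})\Delta=(\mathrm{id}\otimes\Delta)\Delta$. For a functional $\omega$, $(\mathrm{id}\otimes\omega)\Delta(a)\in M(A)$ is the multiplier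 $b\mapsto(\mathrm{id}\otimes\omega)(\Delta(a)(b\otimes1))$, $b\mapsto(\mathrm{id}\otimes\omega)((b\otimes1)\Delta(a))$; similarly $(\omega\otimes\mathrm{id})\Delta(a)$. $(A,\Delta)$ is a regular $I$-partial multiplier bialgebra if there is a (necessarily unique) functional $\varepsilon:A\to\mathbb C$ (counit) with: $\varepsilon({}^r_tA^s_u)=0$ if $r\ne t$ or $s\neq u$; $\varepsilon(A_r)\neq0\neq\varepsilon({}_rA)$ for all $r$; $\varepsilon(ab)=\varepsilon(a)\varepsilon(b)$ for $a\in A^s_t$, $b\in{}^s_tA$; $(\mathrm{id}\otimes\varepsilon)\Delta(a)=a=(\varepsilon\otimes\mathrm{id})\Delta(a)$. It is a regular $I$-partial multiplier Hopf algebra if the following maps are bijective, with $\Delta^{\mathrm{op}}$ the flipped coproduct: $\bigoplus_r A_r\otimes{}_rA\to\bigoplus_r{}_rA\otimes{}^rA$, $a\otimes b\mapsto\Delta(a)(1\otimes b)$; $\bigoplus_rA^r\otimes{}^rA\to\bigoplus_rA_r\otimes A^r$, $a\otimes b\mapsto(a\otimes1)\Delta(b)$; $\bigoplus_rA^r\otimes{}^rA\to\bigoplus_r{}^rA\otimes{}_rA$, $a\otimes b\mapsto\Delta^{\mathrm{op}}(a)(1\otimes b)$; $\bigoplus_rA_r\otimes{}_rA\to\bigoplus_rA^r\otimes A_r$, $a\otimes b\mapsto(a\otimes1)\Delta^{\mathrm{op}}(b)$. $*$-structures. A functional $\varphi$ on $A$ is left invariant if it vanishes on all components other than the ${}^r_sA^r_s$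 and $(\mathrm{id}\otimes\varphi)\Delta(a)=\sum_r\varphi(\mathbf 1^ra)\mathbf 1^r$ for all $a$; faithful if $\varphi(ab)=0$ for all $b$, or $\varphi(ba)=0$ for all $b$, forces $a=0$; positive if $\varphi(a^*a)\ge0$ for all $a$. An $I$-partial multiplier Hopf $*$-algebra is a regular $I$-partial multiplier Hopf algebra whose total algebra $A$ is a $*$-algebra with $({}^r_tA^s_u)^*={}^s_uA^r_t$ and for which $\Delta:A\to M(A\otimes A)$ is a $*$-homomorphism. An $I$-partial $*$-algebraic quantum group is an $I$-partial multiplier Hopf $*$-algebra possessing a positive faithful left invariant functional. A unitary module is a left $A$-module $V$ with $AV=V$, together with a pre-Hilbert space structure on $V$ such that $\langle v,aw\rangle=\langle a^*v,w\rangle$ for all $a\in A$, $v,w\in V$. *)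

theory Defs
  imports "HOL-Analysis.Analysis" "HOL-Library.Poly_Mapping"
begin

section \<open>Complex vector spaces and non-unital complex algebras\<close>

class scaleC =
  fixes scaleC :: "complex \<Rightarrow> 'a \<Rightarrow> 'a" (infixr \<open>*\<^sub>C\<close> 75)

class complex_vector = scaleC + ab_group_add +
  assumes scaleC_add_right: "c *\<^sub>C (x + y) = c *\<^sub>C x + c *\<^sub>C y"
    and scaleC_add_left: "(c + d) *\<^sub>C x = c *\<^sub>C x + d *\<^sub>C x"
    and scaleC_scaleC: "c *\<^sub>C d *\<^sub>C x = (c * d) *\<^sub>C x"
    and scaleC_one: "1 *\<^sub>C x = x"

class complex_algebra = complex_vector + ring +
  assumes mult_scaleC_left: "c *\<^sub>C x * y = c *\<^sub>C (x * y)"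
    and mult_scaleC_right: "x * c *\<^sub>C y = c *\<^sub>C (x * y)"

class complex_star_algebra = complex_algebra +
  fixes star :: "'a \<Rightarrow> 'a"
  assumes star_add: "star (x + y) = star x + star y"
    and star_scaleC: "star (c *\<^sub>C x) = cnj c *\<^sub>C star x"
    and star_mult: "star (x * y) = star y * star x"
    and star_star: "star (star x) = x"

global_interpretation cvec: vector_space "scaleC :: complex \<Rightarrow> 'a \<Rightarrow> 'a::complex_vector"
  by unfold_locales (simp_all add: scaleC_add_right scaleC_add_left scaleC_scaleC scaleC_one)

abbreviation clinear :: "('a::complex_vector \<Rightarrow> 'b::complex_vector) \<Rightarrow> bool"
  where "clinear \<equiv> Vector_Spaces.linear scaleC scaleC"

lemma clinear_iff:
  fixes f :: "'a::complex_vector \<Rightarrow> 'b::complex_vector"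
  shows "clinear f \<longleftrightarrow> (\<forall>x y. f (x + y) = f x + f y) \<and> (\<forall>c x. f (c *\<^sub>C x) = c *\<^sub>C f x)"
  by (simp add: Vector_Spaces.linear_iff cvec.vector_space_axioms)

lemma clinear_add: "clinear f \<Longrightarrow> f (x + y) = f x + f y"
  by (simp add: clinear_iff)

lemma clinear_scaleC: "clinear f \<Longrightarrow> f (c *\<^sub>C x) = c *\<^sub>C f x"
  by (simp add: clinear_iff)

instantiation complex :: complex_algebra
begin
definition scaleC_complex :: "complex \<Rightarrow> complex \<Rightarrow> complex" where "scaleC_complex c x = c * x"
instance by standard (simp_all add: scaleC_complex_def algebra_simps)
end

instantiation poly_mapping :: (type, complex_vector) complex_vector
begin
lift_definition scaleC_poly_mapping :: "complex \<Rightarrow> ('a \<Rightarrow>\<^sub>0 'b) \<Rightarrow> ('a \<Rightarrow>\<^sub>0 'b)"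
  is "\<lambda>c f k. c *\<^sub>C f k"
  by (erule rev_finite_subset) auto
instance
  by standard (transfer; simp add: scaleC_add_right scaleC_add_left scaleC_scaleC scaleC_one)+
end


section \<open>The algebraic tensor product over the complex numbers\<close>

text \<open>The free vector space on \<open>A \<times> B\<close> modulo the bilinearity relations.\<close>

abbreviation free :: "'a \<Rightarrow> 'b \<Rightarrow> ('a \<times> 'b) \<Rightarrow>\<^sub>0 complex"
  where "free a b \<equiv> Poly_Mapping.single (a, b) 1"

definition tensor_relators :: "(('a::complex_vector \<times> 'b::complex_vector) \<Rightarrow>\<^sub>0 complex) set" where
  "tensor_relators =
     {free (a + a') b - free a b - free a' b | a a' b. True} \<union>
     {free a (b + b') - free a b - free a b' | a b b'. True} \<union>
     {free (c *\<^sub>C a) b - c *\<^sub>C free a b | c a b. True} \<union>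
     {free a (c *\<^sub>C b) - c *\<^sub>C free a b | c a b. True}"

definition tensor_rel ::
  "(('a::complex_vector \<times> 'b::complex_vector) \<Rightarrow>\<^sub>0 complex) \<Rightarrow> (('a \<times> 'b) \<Rightarrow>\<^sub>0 complex) \<Rightarrow> bool"
  where "tensor_rel p q \<longleftrightarrow> p - q \<in> cvec.span tensor_relators"

quotient_type (overloaded) ('a, 'b) tensor =
  "(('a::complex_vector \<times> 'b::complex_vector) \<Rightarrow>\<^sub>0 complex)" / tensor_rel
proof (rule equivpI)
  let ?R = "tensor_rel :: (('a \<times> 'b) \<Rightarrow>\<^sub>0 complex) \<Rightarrow> _"
  show "reflp ?R"
    by (auto simp: reflp_def tensor_rel_def cvec.span_zero)
  show "symp ?R"
    unfolding symp_def tensor_rel_def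
  proof (intro allI impI)
    fix x y :: "('a \<times> 'b) \<Rightarrow>\<^sub>0 complex"
    assume "x - y \<in> cvec.span tensor_relators"
    from cvec.span_neg[OF this] show "y - x \<in> cvec.span tensor_relators" by simp
  qed
  show "transp ?R"
    unfolding transp_def tensor_rel_def
  proof (intro allI impI)
    fix x y z :: "('a \<times> 'b) \<Rightarrow>\<^sub>0 complex"
    assume "x - y \<in> cvec.span tensor_relators" "y - z \<in> cvec.span tensor_relators"
    from cvec.span_add[OF this] show "x - z \<in> cvec.span tensor_relators" by simp
  qed
qed

instantiation tensor :: (complex_vector, complex_vector) complex_vector
begin

lift_definition zero_tensor :: "('a, 'b) tensor" is 0 .

lift_definition plus_tensor :: "('a, 'b) tensor \<Rightarrow> ('a, 'b) tensor \<Rightarrow> ('a, 'b) tensor" is "(+)"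
  unfolding tensor_rel_def add_diff_add by (rule cvec.span_add)

lift_definition uminus_tensor :: "('a, 'b) tensor \<Rightarrow> ('a, 'b) tensor" is uminus
  unfolding tensor_rel_def minus_diff_minus by (rule cvec.span_neg)

lift_definition minus_tensor :: "('a, 'b) tensor \<Rightarrow> ('a, 'b) tensor \<Rightarrow> ('a, 'b) tensor" is "(-)"
  unfolding tensor_rel_def diff_diff_eq2 diff_diff_eq
  by (drule (1) cvec.span_diff) (simp add: algebra_simps)

lift_definition scaleC_tensor :: "complex \<Rightarrow> ('a, 'b) tensor \<Rightarrow> ('a, 'b) tensor" is scaleC
  unfolding tensor_rel_def cvec.scale_right_diff_distrib[symmetric] by (rule cvec.span_scale)

instance
proof
  fix x y z :: "('a, 'b) tensor" and c d :: complex
  show "x + y + z = x + (y + z)" by transfer (simp add: tensor_rel_def add.assoc cvec.span_zero)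
  show "x + y = y + x" by transfer (simp add: tensor_rel_def add.commute cvec.span_zero)
  show "0 + x = x" by transfer (simp add: tensor_rel_def cvec.span_zero)
  show "- x + x = 0" by transfer (simp add: tensor_rel_def cvec.span_zero)
  show "x - y = x + - y" by transfer (simp add: tensor_rel_def cvec.span_zero)
  show "c *\<^sub>C (x + y) = c *\<^sub>C x + c *\<^sub>C y"
    by transfer (simp add: tensor_rel_def cvec.span_zero scaleC_add_right)
  show "(c + d) *\<^sub>C x = c *\<^sub>C x + d *\<^sub>C x"
    by transfer (simp add: tensor_rel_def cvec.span_zero scaleC_add_left)
  show "c *\<^sub>C d *\<^sub>C x = (c * d) *\<^sub>C x"
    by transfer (simp add: tensor_rel_def cvec.span_zero scaleC_scaleC)
  show "1 *\<^sub>C x = x"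
    by transfer (simp add: tensor_rel_def cvec.span_zero scaleC_one)
qed

end

lift_definition tens :: "'a::complex_vector \<Rightarrow> 'b::complex_vector \<Rightarrow> ('a, 'b) tensor" (infixr \<open>\<otimes>\<^sub>t\<close> 77)
  is free .

lemma tens_add_left: "(a + a') \<otimes>\<^sub>t b = a \<otimes>\<^sub>t b + a' \<otimes>\<^sub>t b"
  by transfer (unfold tensor_rel_def tensor_relators_def diff_diff_eq[symmetric],
      rule cvec.span_base, blast)

lemma tens_add_right: "a \<otimes>\<^sub>t (b + b') = a \<otimes>\<^sub>t b + a \<otimes>\<^sub>t b'"
  by transfer (unfold tensor_rel_def tensor_relators_def diff_diff_eq[symmetric],
      rule cvec.span_base, blast)

lemma tens_scaleC_left: "(c *\<^sub>C a) \<otimes>\<^sub>t b = c *\<^sub>C (a \<otimes>\<^sub>t b)"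
  by transfer (unfold tensor_rel_def tensor_relators_def, rule cvec.span_base, blast)

lemma tens_scaleC_right: "a \<otimes>\<^sub>t (c *\<^sub>C b) = c *\<^sub>C (a \<otimes>\<^sub>t b)"
  by transfer (unfold tensor_rel_def tensor_relators_def, rule cvec.span_base, blast)

lemma tensor_exhaust: obtains p where "t = abs_tensor p"
  by (metis Quotient3_abs_rep Quotient3_tensor)

lemma tensor_induct [case_names tens add, induct type: tensor]:
  fixes t :: "('a::complex_vector, 'b::complex_vector) tensor"
  assumes tens: "\<And>a b. P (a \<otimes>\<^sub>t b)" and add: "\<And>s t. P s \<Longrightarrow> P t \<Longrightarrow> P (s + t)"
  shows "P t"
proof -
  obtain p where p: "t = abs_tensor p" by (rule tensor_exhaust)
  have "P (abs_tensor p)"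
  proof (induction p rule: update_induct)
    case const
    have "abs_tensor 0 = (0::'a) \<otimes>\<^sub>t (0::'b)"
      using tens_scaleC_left[of 0 "0::'a" "0::'b"] by (simp add: zero_tensor.abs_eq[symmetric])
    then show ?case by (simp add: tens)
  next
    case (update f k v)
    obtain a b where k: "k = (a, b)" by fastforce
    have *: "Poly_Mapping.update k v f = f + v *\<^sub>C free a b"
      using update.hyps(1)
      by (intro poly_mapping_eqI)
        (auto simp: k lookup_update lookup_add lookup_single scaleC_poly_mapping.rep_eq when_def
          scaleC_complex_def in_keys_iff)
    have "abs_tensor (Poly_Mapping.update k v f) = abs_tensor f + (v *\<^sub>C a) \<otimes>\<^sub>t b"
      unfolding * tens_scaleC_left by (simp add: plus_tensor.abs_eq scaleC_tensor.abs_eq tens.abs_eq)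
    then show ?case using add[OF update.IH tens] by simp
  qed
  then show ?thesis using p by simp
qed

text \<open>
  The universal property, also for maps that are conjugate-linear in both variables:
  \<open>\<sigma>\<close> is the identity or the complex conjugation.
\<close>

definition semi_bilinear ::
  "(complex \<Rightarrow> complex) \<Rightarrow> ('a::complex_vector \<Rightarrow> 'b::complex_vector \<Rightarrow> 'c::complex_vector) \<Rightarrow> bool"
  where "semi_bilinear \<sigma> \<beta> \<longleftrightarrow> (\<sigma> = (\<lambda>c. c) \<or> \<sigma> = cnj) \<and>
    (\<forall>a a' b. \<beta> (a + a') b = \<beta> a b + \<beta> a' b) \<and>
    (\<forall>a b b'. \<beta> a (b + b') = \<beta> a b + \<beta> a b') \<and>
    (\<forall>c a b. \<beta> (c *\<^sub>C a) b = \<sigma> c *\<^sub>C \<beta> a b) \<and>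
    (\<forall>c a b. \<beta> a (c *\<^sub>C b) = \<sigma> c *\<^sub>C \<beta> a b)"

definition free_extend :: "(complex \<Rightarrow> complex) \<Rightarrow> ('a \<Rightarrow> 'b \<Rightarrow> 'c::complex_vector)
    \<Rightarrow> (('a \<times> 'b) \<Rightarrow>\<^sub>0 complex) \<Rightarrow> 'c"
  where "free_extend \<sigma> \<beta> p =
    (\<Sum>k\<in>Poly_Mapping.keys p. \<sigma> (Poly_Mapping.lookup p k) *\<^sub>C \<beta> (fst k) (snd k))"

definition tensor_semilift :: "(complex \<Rightarrow> complex) \<Rightarrow>
    ('a::complex_vector \<Rightarrow> 'b::complex_vector \<Rightarrow> 'c::complex_vector) \<Rightarrow> ('a, 'b) tensor \<Rightarrow> 'c"
  where "tensor_semilift \<sigma> \<beta> t = free_extend \<sigma> \<beta> (rep_tensor t)"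

abbreviation tensor_lift ::
  "('a::complex_vector \<Rightarrow> 'b::complex_vector \<Rightarrow> 'c::complex_vector) \<Rightarrow> ('a, 'b) tensor \<Rightarrow> 'c"
  where "tensor_lift \<equiv> tensor_semilift (\<lambda>c. c)"

abbreviation bilinear_map ::
  "('a::complex_vector \<Rightarrow> 'b::complex_vector \<Rightarrow> 'c::complex_vector) \<Rightarrow> bool"
  where "bilinear_map \<equiv> semi_bilinear (\<lambda>c. c)"

lemma free_extend_superset:
  assumes "\<sigma> 0 = 0" "finite S" "Poly_Mapping.keys p \<subseteq> S"
  shows "free_extend \<sigma> \<beta> p = (\<Sum>k\<in>S. \<sigma> (Poly_Mapping.lookup p k) *\<^sub>C \<beta> (fst k) (snd k))"
  unfolding free_extend_def
  by (rule sum.mono_neutral_left) (use assms in \<open>auto simp: in_keys_iff\<close>)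

lemma free_extend_add:
  assumes "\<sigma> = (\<lambda>c. c) \<or> \<sigma> = cnj"
  shows "free_extend \<sigma> \<beta> (p + q) = free_extend \<sigma> \<beta> p + free_extend \<sigma> \<beta> q"
proof -
  let ?S = "Poly_Mapping.keys p \<union> Poly_Mapping.keys q"
  have *: "\<sigma> 0 = 0" "\<And>x y. \<sigma> (x + y) = \<sigma> x + \<sigma> y" using assms by auto
  have "Poly_Mapping.keys (p + q) \<subseteq> ?S" by (rule keys_add)
  then show ?thesis
    by (simp add: free_extend_superset[where S = ?S] * lookup_add scaleC_add_left sum.distrib)
qed

lemma free_extend_scaleC:
  assumes "\<sigma> = (\<lambda>c. c) \<or> \<sigma> = cnj"
  shows "free_extend \<sigma> \<beta> (c *\<^sub>C p) = \<sigma> c *\<^sub>C free_extend \<sigma> \<beta> p"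
proof -
  have *: "\<sigma> 0 = 0" "\<And>x y. \<sigma> (x * y) = \<sigma> x * \<sigma> y" using assms by auto
  have "Poly_Mapping.keys (c *\<^sub>C p) \<subseteq> Poly_Mapping.keys p"
    by (auto simp: in_keys_iff scaleC_poly_mapping.rep_eq)
  then show ?thesis
    by (simp add: free_extend_superset[where S = "Poly_Mapping.keys p"] * scaleC_poly_mapping.rep_eq
        cvec.scale_sum_right scaleC_scaleC scaleC_complex_def)
qed

lemma free_extend_diff:
  assumes "\<sigma> = (\<lambda>c. c) \<or> \<sigma> = cnj"
  shows "free_extend \<sigma> \<beta> (p - q) = free_extend \<sigma> \<beta> p - free_extend \<sigma> \<beta> q"
  using free_extend_add[OF assms, of \<beta> "p - q" q] by simp

lemma free_extend_free:
  assumes "\<sigma> = (\<lambda>c. c) \<or> \<sigma> = cnj"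
  shows "free_extend \<sigma> \<beta> (free a b) = \<beta> a b"
  using assms by (auto simp: free_extend_def scaleC_one)

lemma free_extend_rel:
  assumes "semi_bilinear \<sigma> \<beta>" and "tensor_rel p q"
  shows "free_extend \<sigma> \<beta> p = free_extend \<sigma> \<beta> q"
proof -
  have \<sigma>: "\<sigma> = (\<lambda>c. c) \<or> \<sigma> = cnj" using assms(1) by (simp add: semi_bilinear_def)
  have "p - q \<in> cvec.span tensor_relators" using assms(2) by (simp add: tensor_rel_def)
  then have "free_extend \<sigma> \<beta> (p - q) = 0"
  proof (induction rule: cvec.span_induct)
    case base
    then show ?case
      using free_extend_add[OF \<sigma>, of \<beta> 0 0]
      by (auto simp: cvec.subspace_def free_extend_add[OF \<sigma>] free_extend_scaleC[OF \<sigma>])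
  next
    case (step x)
    note \<beta> = assms(1)[unfolded semi_bilinear_def, THEN conjunct2]
    show ?case
      using step \<beta>
      by (auto simp: tensor_relators_def free_extend_diff[OF \<sigma>] free_extend_scaleC[OF \<sigma>]
          free_extend_free[OF \<sigma>])
  qed
  then show ?thesis by (simp add: free_extend_diff[OF \<sigma>])
qed

lemma tensor_semilift_abs:
  assumes "semi_bilinear \<sigma> \<beta>"
  shows "tensor_semilift \<sigma> \<beta> (abs_tensor p) = free_extend \<sigma> \<beta> p"
  unfolding tensor_semilift_def
  by (rule free_extend_rel[OF assms])
    (simp add: tensor.abs_eq_iff[symmetric] Quotient3_abs_rep[OF Quotient3_tensor])

lemma tensor_semilift_tens [simp]:
  assumes "semi_bilinear \<sigma> \<beta>"
  shows "tensor_semilift \<sigma> \<beta> (a \<otimes>\<^sub>t b) = \<beta> a b"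
  using assms by (simp add: tens.abs_eq tensor_semilift_abs free_extend_free semi_bilinear_def)

lemma tensor_semilift_add:
  assumes "semi_bilinear \<sigma> \<beta>"
  shows "tensor_semilift \<sigma> \<beta> (s + t) = tensor_semilift \<sigma> \<beta> s + tensor_semilift \<sigma> \<beta> t"
proof -
  obtain p where "s = abs_tensor p" by (rule tensor_exhaust)
  moreover obtain q where "t = abs_tensor q" by (rule tensor_exhaust)
  ultimately show ?thesis
    using assms by (simp add: plus_tensor.abs_eq tensor_semilift_abs free_extend_add semi_bilinear_def)
qed

lemma tensor_semilift_scaleC:
  assumes "semi_bilinear \<sigma> \<beta>"
  shows "tensor_semilift \<sigma> \<beta> (c *\<^sub>C t) = \<sigma> c *\<^sub>C tensor_semilift \<sigma> \<beta> t"
proof -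
  obtain p where "t = abs_tensor p" by (rule tensor_exhaust)
  then show ?thesis
    using assms by (simp add: scaleC_tensor.abs_eq tensor_semilift_abs free_extend_scaleC semi_bilinear_def)
qed

lemma clinear_tensor_lift: "bilinear_map \<beta> \<Longrightarrow> clinear (tensor_lift \<beta>)"
  by (simp add: clinear_iff tensor_semilift_add tensor_semilift_scaleC)

definition tensor_map :: "('a::complex_vector \<Rightarrow> 'c::complex_vector) \<Rightarrow>
    ('b::complex_vector \<Rightarrow> 'd::complex_vector) \<Rightarrow> ('a, 'b) tensor \<Rightarrow> ('c, 'd) tensor"
  where "tensor_map f g = tensor_lift (\<lambda>a b. f a \<otimes>\<^sub>t g b)"

lemma bilinear_tensor_map:
  "clinear f \<Longrightarrow> clinear g \<Longrightarrow> bilinear_map (\<lambda>a b. f a \<otimes>\<^sub>t g b)"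
  by (simp add: semi_bilinear_def clinear_iff tens_add_left tens_add_right
      tens_scaleC_left tens_scaleC_right)

lemma tensor_map_tens [simp]:
  "clinear f \<Longrightarrow> clinear g \<Longrightarrow> tensor_map f g (a \<otimes>\<^sub>t b) = f a \<otimes>\<^sub>t g b"
  by (simp add: tensor_map_def bilinear_tensor_map)

lemma clinear_tensor_map: "clinear f \<Longrightarrow> clinear g \<Longrightarrow> clinear (tensor_map f g)"
  by (simp add: tensor_map_def bilinear_tensor_map clinear_tensor_lift)

definition flip :: "('a::complex_vector, 'b::complex_vector) tensor \<Rightarrow> ('b, 'a) tensor"
  where "flip = tensor_lift (\<lambda>a b. b \<otimes>\<^sub>t a)"

lemma bilinear_flip: "bilinear_map (\<lambda>a b. b \<otimes>\<^sub>t a)"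
  by (simp add: semi_bilinear_def tens_add_left tens_add_right tens_scaleC_left tens_scaleC_right)

lemma flip_tens [simp]: "flip (a \<otimes>\<^sub>t b) = b \<otimes>\<^sub>t a"
  by (simp add: flip_def bilinear_flip)

lemma clinear_flip: "clinear flip"
  by (simp add: flip_def bilinear_flip clinear_tensor_lift)

lemma flip_flip [simp]: "flip (flip t) = t"
  by (induction t) (simp_all add: clinear_add[OF clinear_flip])

definition assoc_right :: "(('a::complex_vector, 'b::complex_vector) tensor, 'c::complex_vector) tensor
    \<Rightarrow> ('a, ('b, 'c) tensor) tensor"
  where "assoc_right = tensor_lift (\<lambda>s c. tensor_lift (\<lambda>a b. a \<otimes>\<^sub>t b \<otimes>\<^sub>t c) s)"

definition assoc_left :: "('a::complex_vector, ('b::complex_vector, 'c::complex_vector) tensor) tensor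
    \<Rightarrow> (('a, 'b) tensor, 'c) tensor"
  where "assoc_left = tensor_lift (\<lambda>a s. tensor_lift (\<lambda>b c. (a \<otimes>\<^sub>t b) \<otimes>\<^sub>t c) s)"

lemma bilinear_assoc_right_aux: "bilinear_map (\<lambda>a b. a \<otimes>\<^sub>t b \<otimes>\<^sub>t c)"
  by (simp add: semi_bilinear_def tens_add_left tens_add_right tens_scaleC_left tens_scaleC_right)

lemma bilinear_assoc_left_aux: "bilinear_map (\<lambda>b c. (a \<otimes>\<^sub>t b) \<otimes>\<^sub>t c)"
  by (simp add: semi_bilinear_def tens_add_left tens_add_right tens_scaleC_left tens_scaleC_right)

lemma bilinear_assoc_right:
  "bilinear_map (\<lambda>s c. tensor_lift (\<lambda>a b. a \<otimes>\<^sub>t b \<otimes>\<^sub>t c) s)"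
proof -
  note aux [simp] = bilinear_assoc_right_aux
  have 1: "tensor_lift (\<lambda>a b. a \<otimes>\<^sub>t b \<otimes>\<^sub>t (c + c')) s =
      tensor_lift (\<lambda>a b. a \<otimes>\<^sub>t b \<otimes>\<^sub>t c) s + tensor_lift (\<lambda>a b. a \<otimes>\<^sub>t b \<otimes>\<^sub>t c') s" for s c c'
  proof (induction s)
    case tens
    show ?case by (simp only: tensor_semilift_tens[OF aux]) (simp only: tens_add_right)
  next
    case add
    then show ?case by (simp only: tensor_semilift_add[OF aux] ac_simps)
  qed
  have 2: "tensor_lift (\<lambda>a b. a \<otimes>\<^sub>t b \<otimes>\<^sub>t (k *\<^sub>C c)) s =
      k *\<^sub>C tensor_lift (\<lambda>a b. a \<otimes>\<^sub>t b \<otimes>\<^sub>t c) s" for s c k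
  proof (induction s)
    case tens
    show ?case by (simp only: tensor_semilift_tens[OF aux]) (simp only: tens_scaleC_right)
  next
    case add
    then show ?case by (simp only: tensor_semilift_add[OF aux] scaleC_add_right)
  qed
  show ?thesis
    unfolding semi_bilinear_def by (simp add: 1 2 tensor_semilift_add tensor_semilift_scaleC)
qed

lemma bilinear_assoc_left:
  "bilinear_map (\<lambda>a s. tensor_lift (\<lambda>b c. (a \<otimes>\<^sub>t b) \<otimes>\<^sub>t c) s)"
proof -
  note aux [simp] = bilinear_assoc_left_aux
  have 1: "tensor_lift (\<lambda>b c. ((a + a') \<otimes>\<^sub>t b) \<otimes>\<^sub>t c) s =
      tensor_lift (\<lambda>b c. (a \<otimes>\<^sub>t b) \<otimes>\<^sub>t c) s + tensor_lift (\<lambda>b c. (a' \<otimes>\<^sub>t b) \<otimes>\<^sub>t c) s" for s a a'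
  proof (induction s)
    case tens
    show ?case by (simp only: tensor_semilift_tens[OF aux]) (simp only: tens_add_left)
  next
    case add
    then show ?case by (simp only: tensor_semilift_add[OF aux] ac_simps)
  qed
  have 2: "tensor_lift (\<lambda>b c. ((k *\<^sub>C a) \<otimes>\<^sub>t b) \<otimes>\<^sub>t c) s =
      k *\<^sub>C tensor_lift (\<lambda>b c. (a \<otimes>\<^sub>t b) \<otimes>\<^sub>t c) s" for s a k
  proof (induction s)
    case tens
    show ?case by (simp only: tensor_semilift_tens[OF aux]) (simp only: tens_scaleC_left)
  next
    case add
    then show ?case by (simp only: tensor_semilift_add[OF aux] scaleC_add_right)
  qed
  show ?thesis
    unfolding semi_bilinear_def by (simp add: 1 2 tensor_semilift_add tensor_semilift_scaleC)
qed

lemma assoc_right_tens [simp]: "assoc_right ((a \<otimes>\<^sub>t b) \<otimes>\<^sub>t c) = a \<otimes>\<^sub>t b \<otimes>\<^sub>t c"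
  by (simp add: assoc_right_def bilinear_assoc_right bilinear_assoc_right_aux)

lemma assoc_left_tens [simp]: "assoc_left (a \<otimes>\<^sub>t b \<otimes>\<^sub>t c) = (a \<otimes>\<^sub>t b) \<otimes>\<^sub>t c"
  by (simp add: assoc_left_def bilinear_assoc_left bilinear_assoc_left_aux)

lemma clinear_assoc_right: "clinear assoc_right"
  by (simp add: assoc_right_def bilinear_assoc_right clinear_tensor_lift)

lemma clinear_assoc_left: "clinear assoc_left"
  by (simp add: assoc_left_def bilinear_assoc_left clinear_tensor_lift)

lemma tensor_induct_left:
  fixes t :: "(('a::complex_vector, 'b::complex_vector) tensor, 'c::complex_vector) tensor"
  assumes "\<And>a b c. P ((a \<otimes>\<^sub>t b) \<otimes>\<^sub>t c)" and "\<And>s t. P s \<Longrightarrow> P t \<Longrightarrow> P (s + t)"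
  shows "P t"
proof (induction t)
  case (tens s c)
  show ?case by (induction s) (simp_all add: assms tens_add_left)
qed (rule assms(2))

lemma tensor_induct_right:
  fixes t :: "('a::complex_vector, ('b::complex_vector, 'c::complex_vector) tensor) tensor"
  assumes "\<And>a b c. P (a \<otimes>\<^sub>t b \<otimes>\<^sub>t c)" and "\<And>s t. P s \<Longrightarrow> P t \<Longrightarrow> P (s + t)"
  shows "P t"
proof (induction t)
  case (tens a s)
  show ?case by (induction s) (simp_all add: assms tens_add_right)
qed (rule assms(2))

lemma assoc_left_right [simp]: "assoc_left (assoc_right t) = t"
  by (induction t rule: tensor_induct_left)
    (simp_all add: clinear_add[OF clinear_assoc_left] clinear_add[OF clinear_assoc_right])

lemma assoc_right_left [simp]: "assoc_right (assoc_left t) = t"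
  by (induction t rule: tensor_induct_right)
    (simp_all add: clinear_add[OF clinear_assoc_left] clinear_add[OF clinear_assoc_right])

lemma clinear_mult_left: "clinear ((*) a)" for a :: "'a::complex_algebra"
  by (simp add: clinear_iff distrib_left mult_scaleC_right)

lemma clinear_mult_right: "clinear (\<lambda>x. x * a)" for a :: "'a::complex_algebra"
  by (simp add: clinear_iff distrib_right mult_scaleC_left)

instantiation tensor :: (complex_algebra, complex_algebra) complex_algebra
begin

definition times_tensor :: "('a, 'b) tensor \<Rightarrow> ('a, 'b) tensor \<Rightarrow> ('a, 'b) tensor"
  where "s * t = tensor_lift (\<lambda>a b. tensor_map ((*) a) ((*) b) t) s"

instance proof
  note lin [simp] = clinear_mult_left
  have map_add: "tensor_map ((*) a) ((*) b) (s + t) =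
      tensor_map ((*) a) ((*) b) s + tensor_map ((*) a) ((*) b) t"
    for a :: 'a and b :: 'b and s t
    using clinear_tensor_map[OF lin lin, of a b] by (simp add: clinear_iff)
  have map_scale: "tensor_map ((*) a) ((*) b) (c *\<^sub>C s) = c *\<^sub>C tensor_map ((*) a) ((*) b) s"
    for a :: 'a and b :: 'b and s c
    using clinear_tensor_map[OF lin lin, of a b] by (simp add: clinear_iff)
  have 1: "tensor_map ((*) (a + a')) ((*) b) t =
      tensor_map ((*) a) ((*) b) t + tensor_map ((*) a') ((*) b) t" for a a' :: 'a and b :: 'b and t
  proof (induction t)
    case tens
    show ?case by (simp only: tensor_map_tens[OF lin lin]) (simp only: distrib_right tens_add_left)
  next
    case add
    then show ?case by (simp only: map_add ac_simps)
  qed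
  have 2: "tensor_map ((*) a) ((*) (b + b')) t =
      tensor_map ((*) a) ((*) b) t + tensor_map ((*) a) ((*) b') t" for a :: 'a and b b' :: 'b and t
  proof (induction t)
    case tens
    show ?case by (simp only: tensor_map_tens[OF lin lin]) (simp only: distrib_right tens_add_right)
  next
    case add
    then show ?case by (simp only: map_add ac_simps)
  qed
  have 3: "tensor_map ((*) (c *\<^sub>C a)) ((*) b) t = c *\<^sub>C tensor_map ((*) a) ((*) b) t"
    for a :: 'a and b :: 'b and t c
  proof (induction t)
    case tens
    show ?case by (simp only: tensor_map_tens[OF lin lin]) (simp only: mult_scaleC_left tens_scaleC_left)
  next
    case add
    then show ?case by (simp only: map_add scaleC_add_right)
  qed
  have 4: "tensor_map ((*) a) ((*) (c *\<^sub>C b)) t = c *\<^sub>C tensor_map ((*) a) ((*) b) t"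
    for a :: 'a and b :: 'b and t c
  proof (induction t)
    case tens
    show ?case by (simp only: tensor_map_tens[OF lin lin]) (simp only: mult_scaleC_left tens_scaleC_right)
  next
    case add
    then show ?case by (simp only: map_add scaleC_add_right)
  qed
  have bil [simp]: "bilinear_map (\<lambda>a b. tensor_map ((*) a) ((*) b) t)" for t :: "('a, 'b) tensor"
    by (simp add: semi_bilinear_def 1 2 3 4)
  have tm: "(a \<otimes>\<^sub>t b) * t = tensor_map ((*) a) ((*) b) t" for a :: 'a and b :: 'b and t
    by (simp add: times_tensor_def)
  have tt: "(a \<otimes>\<^sub>t b) * (c \<otimes>\<^sub>t d) = (a * c) \<otimes>\<^sub>t (b * d)" for a c :: 'a and b d :: 'b
    by (simp add: tm)
  fix x y z :: "('a, 'b) tensor" and c :: complex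
  show dl: "(x + y) * z = x * z + y * z" for x y z :: "('a, 'b) tensor"
    by (simp add: times_tensor_def tensor_semilift_add)
  show dr: "x * (y + z) = x * y + x * z" for x y z :: "('a, 'b) tensor"
    by (induction x) (simp_all add: dl tm map_add ac_simps)
  show "x * y * z = x * (y * z)"
  proof (induction x)
    case (tens a b)
    show ?case
    proof (induction y)
      case (tens c d)
      show ?case by (induction z) (simp_all add: tt dr mult.assoc)
    qed (simp add: dl dr)
  qed (simp add: dl)
  show "c *\<^sub>C x * y = c *\<^sub>C (x * y)"
    by (simp add: times_tensor_def tensor_semilift_scaleC)
  show "x * c *\<^sub>C y = c *\<^sub>C (x * y)"
    by (induction x) (simp_all add: dl tm map_scale scaleC_add_right)
qed

end

lemma tens_mult [simp]: "(a \<otimes>\<^sub>t b) * (c \<otimes>\<^sub>t d) = (a * c) \<otimes>\<^sub>t (b * d)"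
proof -
  have "bilinear_map (\<lambda>a b. (a * c) \<otimes>\<^sub>t (b * d))"
    by (rule bilinear_tensor_map[OF clinear_mult_right clinear_mult_right])
  then show ?thesis
    by (simp add: times_tensor_def clinear_mult_left)
qed

lemma flip_mult: "flip (s * t) = flip s * flip t"
proof (induction s)
  case (tens a b)
  show ?case
    by (induction t) (simp_all add: clinear_add[OF clinear_flip] distrib_left)
qed (simp_all add: clinear_add[OF clinear_flip] distrib_right)

lemma assoc_right_mult: "assoc_right (s * t) = assoc_right s * assoc_right t"
proof (induction s rule: tensor_induct_left)
  case (1 a b c)
  show ?case
    by (induction t rule: tensor_induct_left)
      (simp_all add: clinear_add[OF clinear_assoc_right] distrib_left)
qed (simp_all add: clinear_add[OF clinear_assoc_right] distrib_right)

instantiation tensor :: (complex_star_algebra, complex_star_algebra) complex_star_algebra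
begin

definition star_tensor :: "('a, 'b) tensor \<Rightarrow> ('a, 'b) tensor"
  where "star_tensor = tensor_semilift cnj (\<lambda>a b. star a \<otimes>\<^sub>t star b)"

instance proof
  have bil [simp]: "semi_bilinear cnj (\<lambda>(a::'a) (b::'b). star a \<otimes>\<^sub>t star b)"
    by (simp add: semi_bilinear_def star_add star_scaleC tens_add_left tens_add_right
        tens_scaleC_left tens_scaleC_right)
  have st: "star (a \<otimes>\<^sub>t b) = star a \<otimes>\<^sub>t star b" for a :: 'a and b :: 'b
    by (simp add: star_tensor_def)
  fix x y :: "('a, 'b) tensor" and c :: complex
  show add': "star (x + y) = star x + star y" for x y :: "('a, 'b) tensor"
    by (simp add: star_tensor_def tensor_semilift_add)
  show "star (c *\<^sub>C x) = cnj c *\<^sub>C star x"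
    by (simp add: star_tensor_def tensor_semilift_scaleC)
  show "star (x * y) = star y * star x"
  proof (induction x)
    case (tens a b)
    show ?case by (induction y) (simp_all add: st add' star_mult distrib_left distrib_right)
  qed (simp add: add' distrib_left distrib_right)
  show "star (star x) = x"
    by (induction x) (simp_all add: st add' star_star)
qed

end


section \<open>The multiplier algebra\<close>

typedef (overloaded) 'a multiplier =
  "{(l, r). clinear l \<and> clinear r \<and> (\<forall>a b :: 'a::complex_algebra. a * l b = r a * b)}"
  by (rule exI[of _ "(\<lambda>x. 0, \<lambda>x. 0)"]) (simp add: clinear_iff)

setup_lifting type_definition_multiplier

text \<open>\<open>m \<rhd> a\<close> is \<open>ma\<close> and \<open>a \<lhd> m\<close> is \<open>am\<close>.\<close>

lift_definition lact :: "'a::complex_algebra multiplier \<Rightarrow> 'a \<Rightarrow> 'a" (infixr \<open>\<rhd>\<close> 71) is fst .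

lift_definition ract :: "'a \<Rightarrow> 'a::complex_algebra multiplier \<Rightarrow> 'a" (infixl \<open>\<lhd>\<close> 71)
  is "\<lambda>a m. snd m a" .

lemma multiplier_eqI: "(\<And>a. m \<rhd> a = n \<rhd> a) \<Longrightarrow> (\<And>a. a \<lhd> m = a \<lhd> n) \<Longrightarrow> m = n"
  by transfer (auto simp: fun_eq_iff)

lemma clinear_lact: "clinear (lact m)"
  by transfer auto

lemma clinear_ract: "clinear (\<lambda>a. a \<lhd> m)"
  by transfer auto

lemma multiplier_compat: "a * (m \<rhd> b) = (a \<lhd> m) * b"
  by transfer auto

text \<open>Unspecified unless \<open>(l, r)\<close> is a multiplier.\<close>

definition multiplier :: "('a \<Rightarrow> 'a) \<Rightarrow> ('a \<Rightarrow> 'a) \<Rightarrow> 'a::complex_algebra multiplier"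
  where "multiplier l r = Abs_multiplier (l, r)"

lemma multiplier_act:
  assumes "clinear l" "clinear r" "\<And>a b. a * l b = r a * b"
  shows "multiplier l r \<rhd> a = l a" "a \<lhd> multiplier l r = r a"
  using assms by (simp_all add: multiplier_def lact.rep_eq ract.rep_eq Abs_multiplier_inverse)

instantiation multiplier :: (complex_algebra) "{complex_algebra, monoid_mult}"
begin

lift_definition zero_multiplier :: "'a multiplier" is "(\<lambda>x. 0, \<lambda>x. 0)"
  by (simp add: clinear_iff)

lift_definition one_multiplier :: "'a multiplier" is "(\<lambda>x. x, \<lambda>x. x)"
  by (simp add: clinear_iff)

lift_definition plus_multiplier :: "'a multiplier \<Rightarrow> 'a multiplier \<Rightarrow> 'a multiplier"
  is "\<lambda>m n. (\<lambda>x. fst m x + fst n x, \<lambda>x. snd m x + snd n x)"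
  by (auto simp: clinear_iff algebra_simps scaleC_add_right)

lift_definition uminus_multiplier :: "'a multiplier \<Rightarrow> 'a multiplier"
  is "\<lambda>m. (\<lambda>x. - fst m x, \<lambda>x. - snd m x)"
  by (auto simp: clinear_iff algebra_simps cvec.scale_minus_right)

lift_definition minus_multiplier :: "'a multiplier \<Rightarrow> 'a multiplier \<Rightarrow> 'a multiplier"
  is "\<lambda>m n. (\<lambda>x. fst m x - fst n x, \<lambda>x. snd m x - snd n x)"
  by (auto simp: clinear_iff algebra_simps cvec.scale_right_diff_distrib)

lift_definition scaleC_multiplier :: "complex \<Rightarrow> 'a multiplier \<Rightarrow> 'a multiplier"
  is "\<lambda>c m. (\<lambda>x. c *\<^sub>C fst m x, \<lambda>x. c *\<^sub>C snd m x)"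
  by (auto simp: clinear_iff scaleC_add_right mult_scaleC_left mult_scaleC_right mult.commute)

lift_definition times_multiplier :: "'a multiplier \<Rightarrow> 'a multiplier \<Rightarrow> 'a multiplier"
  is "\<lambda>m n. (\<lambda>x. fst m (fst n x), \<lambda>x. snd n (snd m x))"
  by (auto simp: clinear_iff)

instance
proof
  fix x y z :: "'a multiplier" and c d :: complex
  show "x + y + z = x + (y + z)" by transfer (simp add: add.assoc)
  show "x + y = y + x" by transfer (simp add: add.commute)
  show "0 + x = x" by transfer (auto simp: fun_eq_iff)
  show "- x + x = 0" by transfer (auto simp: fun_eq_iff)
  show "x - y = x + - y" by transfer auto
  show "c *\<^sub>C (x + y) = c *\<^sub>C x + c *\<^sub>C y" by transfer (simp add: scaleC_add_right)
  show "(c + d) *\<^sub>C x = c *\<^sub>C x + d *\<^sub>C x" by transfer (simp add: scaleC_add_left)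
  show "c *\<^sub>C d *\<^sub>C x = (c * d) *\<^sub>C x" by transfer (simp add: scaleC_scaleC)
  show "1 *\<^sub>C x = x" by transfer (auto simp: scaleC_one)
  show "x * y * z = x * (y * z)" by transfer simp
  show "1 * x = x" "x * 1 = x" by (transfer; auto)+
  show "(x + y) * z = x * z + y * z" by transfer (auto simp: clinear_iff)
  show "x * (y + z) = x * y + x * z" by transfer (auto simp: clinear_iff)
  show "c *\<^sub>C x * y = c *\<^sub>C (x * y)" by transfer (auto simp: clinear_iff)
  show "x * c *\<^sub>C y = c *\<^sub>C (x * y)" by transfer (auto simp: clinear_iff)
qed

end

instantiation multiplier :: (complex_star_algebra) complex_star_algebra
begin

text \<open>\<open>m\<^sup>* a = (a\<^sup>* m)\<^sup>*\<close> and \<open>a m\<^sup>* = (m a\<^sup>*)\<^sup>*\<close>.\<close>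

lift_definition star_multiplier :: "'a multiplier \<Rightarrow> 'a multiplier"
  is "\<lambda>m. (\<lambda>x. star (snd m (star x)), \<lambda>x. star (fst m (star x)))"
proof clarsimp
  fix l r :: "'a \<Rightarrow> 'a"
  assume *: "clinear l" "clinear r" "\<forall>a b. a * l b = r a * b"
  have "a * star (r (star b)) = star (l (star a)) * b" for a b
  proof -
    have "star (star b * l (star a)) = star (r (star b) * star a)" using *(3) by simp
    then show ?thesis by (simp add: star_mult star_star)
  qed
  then show "clinear (\<lambda>x. star (r (star x))) \<and> clinear (\<lambda>x. star (l (star x))) \<and>
      (\<forall>a b. a * star (r (star b)) = star (l (star a)) * b)"
    using *(1,2) by (simp add: clinear_iff star_add star_scaleC)
qed

instance
  by standard (transfer; auto simp: star_add star_scaleC star_star)+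

end

lift_definition embed :: "'a::complex_algebra \<Rightarrow> 'a multiplier"
  is "\<lambda>a. (\<lambda>x. a * x, \<lambda>x. x * a)"
  by (simp add: clinear_mult_left clinear_mult_right mult.assoc)

text \<open>The inclusion \<open>M(A) \<otimes> M(B) \<rightarrow> M(A \<otimes> B)\<close> on elementary tensors.\<close>

lift_definition mtens :: "'a::complex_algebra multiplier \<Rightarrow> 'b::complex_algebra multiplier
    \<Rightarrow> ('a, 'b) tensor multiplier" (infixr \<open>\<otimes>\<^sub>m\<close> 77)
  is "\<lambda>m n. (tensor_map (fst m) (fst n), tensor_map (snd m) (snd n))"
proof clarsimp
  fix l r :: "'a \<Rightarrow> 'a" and l' r' :: "'b \<Rightarrow> 'b"
  assume *: "clinear l" "clinear r" "clinear l'" "clinear r'"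
    and c: "\<forall>a b. a * l b = r a * b" "\<forall>a b. a * l' b = r' a * b"
  have **: "clinear (tensor_map l l')" "clinear (tensor_map r r')"
    using * by (simp_all add: clinear_tensor_map)
  have "s * tensor_map l l' t = tensor_map r r' s * t" for s t
  proof (induction s)
    case (tens a b)
    show ?case
      by (induction t) (use * ** c in \<open>auto simp: clinear_iff[of "tensor_map _ _"] distrib_left\<close>)
  qed (use ** in \<open>auto simp: clinear_iff distrib_right\<close>)
  with ** show "clinear (tensor_map l l') \<and> clinear (tensor_map r r') \<and>
      (\<forall>a b. a * tensor_map l l' b = tensor_map r r' a * b)" by simp
qed

lift_definition mflip :: "('a::complex_algebra, 'b::complex_algebra) tensor multiplier
    \<Rightarrow> ('b, 'a) tensor multiplier"
  is "\<lambda>m. (\<lambda>x. flip (fst m (flip x)), \<lambda>x. flip (snd m (flip x)))"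
proof clarsimp
  fix l r :: "('a, 'b) tensor \<Rightarrow> ('a, 'b) tensor"
  assume *: "clinear l" "clinear r" "\<forall>a b. a * l b = r a * b"
  have "x * flip (l (flip y)) = flip (flip x * l (flip y))" for x y by (simp add: flip_mult)
  also have "flip (flip x * l (flip y)) = flip (r (flip x)) * y" for x y
    by (simp add: *(3) flip_mult)
  finally show "clinear (\<lambda>x. flip (l (flip x))) \<and> clinear (\<lambda>x. flip (r (flip x))) \<and>
      (\<forall>a b. a * flip (l (flip b)) = flip (r (flip a)) * b)"
    using *(1,2)
    by (simp add: clinear_iff clinear_add[OF clinear_flip] clinear_scaleC[OF clinear_flip])
qed

lift_definition massoc ::
  "(('a::complex_algebra, 'b::complex_algebra) tensor, 'c::complex_algebra) tensor multiplier
    \<Rightarrow> ('a, ('b, 'c) tensor) tensor multiplier"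
  is "\<lambda>m. (\<lambda>x. assoc_right (fst m (assoc_left x)), \<lambda>x. assoc_right (snd m (assoc_left x)))"
proof clarsimp
  fix l r :: "(('a, 'b) tensor, 'c) tensor \<Rightarrow> (('a, 'b) tensor, 'c) tensor"
  assume *: "clinear l" "clinear r" "\<forall>a b. a * l b = r a * b"
  have "x * assoc_right (l (assoc_left y)) = assoc_right (assoc_left x * l (assoc_left y))" for x y
    by (simp add: assoc_right_mult)
  also have "assoc_right (assoc_left x * l (assoc_left y)) = assoc_right (r (assoc_left x)) * y"
    for x y
    by (simp add: *(3) assoc_right_mult)
  finally show "clinear (\<lambda>x. assoc_right (l (assoc_left x))) \<and>
      clinear (\<lambda>x. assoc_right (r (assoc_left x))) \<and>
      (\<forall>a b. a * assoc_right (l (assoc_left b)) = assoc_right (r (assoc_left a)) * b)"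
    using *(1,2)
    by (simp add: clinear_iff clinear_add[OF clinear_assoc_left] clinear_scaleC[OF clinear_assoc_left]
        clinear_add[OF clinear_assoc_right] clinear_scaleC[OF clinear_assoc_right])
qed

definition strict_tendsto ::
  "('x \<Rightarrow> 'a::complex_algebra multiplier) \<Rightarrow> 'a multiplier \<Rightarrow> 'x filter \<Rightarrow> bool"
  where "strict_tendsto f m F \<longleftrightarrow>
    (\<forall>a. eventually (\<lambda>x. f x \<rhd> a = m \<rhd> a \<and> a \<lhd> f x = a \<lhd> m) F)"

definition strict_sum :: "'x set \<Rightarrow> ('x \<Rightarrow> 'a::complex_algebra multiplier) \<Rightarrow> 'a multiplier"
  where "strict_sum S f = (THE m. strict_tendsto (sum f) m (finite_subsets_at_top S))"


section \<open>Partial algebras\<close>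

definition product_span :: "'a::complex_algebra set \<Rightarrow> 'a set \<Rightarrow> 'a set"
  where "product_span V W = cvec.span {v * w | v w. v \<in> V \<and> w \<in> W}"

definition left_nondegenerate :: "'a::complex_algebra set \<Rightarrow> bool"
  where "left_nondegenerate B \<longleftrightarrow> (\<forall>b\<in>B. (\<forall>x\<in>B. b * x = 0) \<longrightarrow> b = 0)"

definition right_nondegenerate :: "'a::complex_algebra set \<Rightarrow> bool"
  where "right_nondegenerate B \<longleftrightarrow> (\<forall>b\<in>B. (\<forall>x\<in>B. x * b = 0) \<longrightarrow> b = 0)"

definition idempotent_algebra :: "'a::complex_algebra set \<Rightarrow> bool"
  where "idempotent_algebra B \<longleftrightarrow> product_span B B = B"

definition is_direct_sum :: "'k set \<Rightarrow> ('k \<Rightarrow> 'a::complex_vector set) \<Rightarrow> bool"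
  where "is_direct_sum K U \<longleftrightarrow> (\<forall>k\<in>K. cvec.subspace (U k)) \<and>
    (\<forall>a. \<exists>!c. (\<forall>k\<in>K. c k \<in> U k) \<and> (\<forall>k. k \<notin> K \<longrightarrow> c k = 0) \<and>
      finite {k. c k \<noteq> 0} \<and> a = (\<Sum>k | c k \<noteq> 0. c k))"

text \<open>
  The total algebra is the whole type; \<open>C r s\<close> is the component \<open>A(r,s)\<close>, and is
  irrelevant unless \<open>r\<close> and \<open>s\<close> lie in the index set \<open>J\<close>.
\<close>

definition partial_algebra :: "'j set \<Rightarrow> ('j \<Rightarrow> 'j \<Rightarrow> 'a::complex_algebra set) \<Rightarrow> bool"
  where "partial_algebra J C \<longleftrightarrow> is_direct_sum (J \<times> J) (\<lambda>(r, s). C r s) \<and>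
    (\<forall>r\<in>J. \<forall>s\<in>J. \<forall>s'\<in>J. \<forall>t\<in>J. s \<noteq> s' \<longrightarrow> (\<forall>a\<in>C r s. \<forall>b\<in>C s' t. a * b = 0)) \<and>
    (\<forall>r\<in>J. \<forall>s\<in>J. \<forall>t\<in>J. \<forall>a\<in>C r s. \<forall>b\<in>C s t. a * b \<in> C r t)"

definition base_unit ::
  "'j set \<Rightarrow> ('j \<Rightarrow> 'j \<Rightarrow> 'a::complex_algebra set) \<Rightarrow> 'j \<Rightarrow> 'a multiplier"
  where "base_unit J C r = (THE m. \<forall>r'\<in>J. \<forall>s'\<in>J. \<forall>a\<in>C r' s'.
    m \<rhd> a = (if r = r' then a else 0) \<and> a \<lhd> m = (if r = s' then a else 0))"

text \<open>
  \<open>A \<^bold>1(s)\<close> and \<open>\<^bold>1(r) A\<close>, as sums of components. They are written without the base units so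
  that they also apply to \<open>A \<otimes>\<^sup>I A\<close>, which is a proper subalgebra of the type of \<open>A \<otimes> A\<close>.
\<close>

definition col_space :: "'j set \<Rightarrow> ('j \<Rightarrow> 'j \<Rightarrow> 'a::complex_algebra set) \<Rightarrow> 'j \<Rightarrow> 'a set"
  where "col_space J C s = cvec.span (\<Union>r\<in>J. C r s)"

definition row_space :: "'j set \<Rightarrow> ('j \<Rightarrow> 'j \<Rightarrow> 'a::complex_algebra set) \<Rightarrow> 'j \<Rightarrow> 'a set"
  where "row_space J C r = cvec.span (\<Union>s\<in>J. C r s)"

definition nondegenerate_partial_algebra ::
  "'j set \<Rightarrow> ('j \<Rightarrow> 'j \<Rightarrow> 'a::complex_algebra set) \<Rightarrow> bool"
  where "nondegenerate_partial_algebra J C \<longleftrightarrow> partial_algebra J C \<and>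
    (\<forall>r\<in>J. left_nondegenerate (col_space J C r) \<and> right_nondegenerate (row_space J C r))"

definition idempotent_partial_algebra ::
  "'j set \<Rightarrow> ('j \<Rightarrow> 'j \<Rightarrow> 'a::complex_algebra set) \<Rightarrow> bool"
  where "idempotent_partial_algebra J C \<longleftrightarrow> partial_algebra J C \<and>
    (\<forall>r\<in>J. idempotent_algebra (col_space J C r) \<and> idempotent_algebra (row_space J C r))"

definition corner :: "'b::complex_algebra multiplier \<Rightarrow> 'b multiplier set"
  where "corner E = {E * m * E | m. True}"

text \<open>
  A morphism into a partial algebra with components \<open>D r s\<close> whose total algebra \<open>B\<close> is a corner
  \<open>E B' E\<close> of the type \<open>B'\<close>; its multiplier algebra is identified with \<open>E M(B') E\<close>.
\<close>

definition partial_morphism :: "'j set \<Rightarrow> ('j \<Rightarrow> 'j \<Rightarrow> 'a::complex_algebra set) \<Rightarrow>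
    'b::complex_algebra multiplier \<Rightarrow> ('j \<Rightarrow> 'j \<Rightarrow> 'b set) \<Rightarrow> ('a \<Rightarrow> 'b multiplier) \<Rightarrow> bool"
  where "partial_morphism J C E D f \<longleftrightarrow>
    clinear f \<and> (\<forall>a b. f (a * b) = f a * f b) \<and> range f \<subseteq> corner E \<and>
    (\<forall>r\<in>J.
      cvec.span {b \<lhd> f a | b a. b \<in> col_space J D r \<and> a \<in> col_space J C r} = col_space J D r \<and>
      cvec.span {f a \<rhd> b | a b. a \<in> row_space J C r \<and> b \<in> row_space J D r} = row_space J D r)"

text \<open>
  \<open>F\<close> is a unital homomorphism \<open>E M(A') E \<rightarrow> E' M(B') E'\<close> extending \<open>f\<close> on the subalgebra \<open>S\<close>
  (viewed inside \<open>E M(A') E\<close>). The values of \<open>F\<close> outside \<open>E M(A') E\<close> are irrelevant.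
\<close>

definition unital_extension :: "'a::complex_algebra multiplier \<Rightarrow> 'b::complex_algebra multiplier \<Rightarrow>
    'a set \<Rightarrow> ('a \<Rightarrow> 'b multiplier) \<Rightarrow> ('a multiplier \<Rightarrow> 'b multiplier) \<Rightarrow> bool"
  where "unital_extension E E' S f F \<longleftrightarrow>
    F ` corner E \<subseteq> corner E' \<and> F E = E' \<and>
    (\<forall>m\<in>corner E. \<forall>n\<in>corner E. F (m + n) = F m + F n \<and> F (m * n) = F m * F n) \<and>
    (\<forall>c. \<forall>m\<in>corner E. F (c *\<^sub>C m) = c *\<^sub>C F m) \<and>
    (\<forall>x\<in>S. F (embed x) = f x)"


section \<open>Algebras graded by pairs of columns\<close>

text \<open>In an \<open>I\<^sup>2\<close>-partial algebra, \<open>C (r, t) (s, u)\<close> is the component with left indices \<open>r\<close>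
  (upper), \<open>t\<close> (lower) and right indices \<open>s\<close> (upper), \<open>u\<close> (lower).\<close>

type_synonym ('i, 'a) components = "'i \<times> 'i \<Rightarrow> 'i \<times> 'i \<Rightarrow> 'a set"

definition unit_up :: "'i set \<Rightarrow> ('i, 'a::complex_algebra) components \<Rightarrow> 'i \<Rightarrow> 'a multiplier"
  where "unit_up I C r = strict_sum I (\<lambda>t. base_unit (I \<times> I) C (r, t))"

definition unit_low :: "'i set \<Rightarrow> ('i, 'a::complex_algebra) components \<Rightarrow> 'i \<Rightarrow> 'a multiplier"
  where "unit_low I C t = strict_sum I (\<lambda>r. base_unit (I \<times> I) C (r, t))"

definition right_up :: "'i set \<Rightarrow> ('i, 'a::complex_algebra) components \<Rightarrow> 'i \<Rightarrow> 'a set"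
  where "right_up I C s = {a \<lhd> unit_up I C s | a. True}"

definition right_low :: "'i set \<Rightarrow> ('i, 'a::complex_algebra) components \<Rightarrow> 'i \<Rightarrow> 'a set"
  where "right_low I C u = {a \<lhd> unit_low I C u | a. True}"

definition left_up :: "'i set \<Rightarrow> ('i, 'a::complex_algebra) components \<Rightarrow> 'i \<Rightarrow> 'a set"
  where "left_up I C r = {unit_up I C r \<rhd> a | a. True}"

definition left_low :: "'i set \<Rightarrow> ('i, 'a::complex_algebra) components \<Rightarrow> 'i \<Rightarrow> 'a set"
  where "left_low I C t = {unit_low I C t \<rhd> a | a. True}"

text \<open>\<open>A \<otimes>\<^sup>I A = E(A \<otimes> A)E\<close> with \<open>E = \<Sum>\<^sub>t \<^bold>1\<^sub>t \<otimes> \<^bold>1\<^sup>t\<close>.\<close>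

definition tensor_unit ::
  "'i set \<Rightarrow> ('i, 'a::complex_algebra) components \<Rightarrow> ('a, 'a) tensor multiplier"
  where "tensor_unit I C = strict_sum I (\<lambda>t. unit_low I C t \<otimes>\<^sub>m unit_up I C t)"

definition tensor_components ::
  "'i set \<Rightarrow> ('i, 'a::complex_algebra) components \<Rightarrow> ('i, ('a, 'a) tensor) components"
  where "tensor_components I C = (\<lambda>(r, v) (s, w).
    cvec.span {a \<otimes>\<^sub>t b | a b. \<exists>t\<in>I. \<exists>u\<in>I. a \<in> C (r, t) (s, u) \<and> b \<in> C (t, v) (u, w)})"

definition partial_tensor ::
  "'i set \<Rightarrow> ('i, 'a::complex_algebra) components \<Rightarrow> ('a, 'a) tensor set"
  where "partial_tensor I C = cvec.span (\<Union>p\<in>I \<times> I. \<Union>q\<in>I \<times> I. tensor_components I C p q)"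

text \<open>
  The units of \<open>M((A \<otimes>\<^sup>I A) \<otimes>\<^sup>I A)\<close> and \<open>M(A \<otimes>\<^sup>I (A \<otimes>\<^sup>I A))\<close>: in \<open>M(A \<otimes>\<^sup>I A)\<close> one has
  \<open>\<^bold>1\<^sub>t = E(1 \<otimes> \<^bold>1\<^sub>t)\<close> and \<open>\<^bold>1\<^sup>t = E(\<^bold>1\<^sup>t \<otimes> 1)\<close>.
\<close>

definition tensor_unit_left ::
  "'i set \<Rightarrow> ('i, 'a::complex_algebra) components \<Rightarrow> (('a, 'a) tensor, 'a) tensor multiplier"
  where "tensor_unit_left I C =
    strict_sum I (\<lambda>t. (tensor_unit I C * (1 \<otimes>\<^sub>m unit_low I C t)) \<otimes>\<^sub>m unit_up I C t)"

definition tensor_unit_right ::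
  "'i set \<Rightarrow> ('i, 'a::complex_algebra) components \<Rightarrow> ('a, ('a, 'a) tensor) tensor multiplier"
  where "tensor_unit_right I C =
    strict_sum I (\<lambda>t. unit_low I C t \<otimes>\<^sub>m (tensor_unit I C * (unit_up I C t \<otimes>\<^sub>m 1)))"


section \<open>Partial multiplier bialgebras and Hopf algebras\<close>

text \<open>
  In coassociativity, \<open>F\<close> and \<open>G\<close> are the (unique) extensions of \<open>\<Delta> \<otimes> id\<close> and \<open>id \<otimes> \<Delta>\<close> to
  \<open>M(A \<otimes>\<^sup>I A) = E M(A \<otimes> A) E\<close>.
\<close>

definition coassociative :: "'i set \<Rightarrow> ('i, 'a::complex_algebra) components \<Rightarrow>
    ('a \<Rightarrow> ('a, 'a) tensor multiplier) \<Rightarrow> bool"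
  where "coassociative I C \<Delta> \<longleftrightarrow> (\<exists>F G.
    unital_extension (tensor_unit I C) (tensor_unit_left I C) (partial_tensor I C)
      (tensor_lift (\<lambda>a b. \<Delta> a \<otimes>\<^sub>m embed b)) F \<and>
    unital_extension (tensor_unit I C) (tensor_unit_right I C) (partial_tensor I C)
      (tensor_lift (\<lambda>a b. embed a \<otimes>\<^sub>m \<Delta> b)) G \<and>
    (\<forall>a. massoc (F (\<Delta> a)) = G (\<Delta> a)))"

definition regular_comultiplication :: "'i set \<Rightarrow> ('i, 'a::complex_algebra) components \<Rightarrow>
    ('a \<Rightarrow> ('a, 'a) tensor multiplier) \<Rightarrow> bool"
  where "regular_comultiplication I C \<Delta> \<longleftrightarrow>
    partial_morphism (I \<times> I) C (tensor_unit I C) (tensor_components I C) \<Delta> \<and>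
    (\<forall>a b. \<Delta> a * (embed b \<otimes>\<^sub>m 1) \<in> range embed \<and> \<Delta> a * (1 \<otimes>\<^sub>m embed b) \<in> range embed \<and>
      (embed b \<otimes>\<^sub>m 1) * \<Delta> a \<in> range embed \<and> (1 \<otimes>\<^sub>m embed b) * \<Delta> a \<in> range embed) \<and>
    coassociative I C \<Delta>"

definition slice_right :: "('b \<Rightarrow> complex) \<Rightarrow> ('a::complex_vector, 'b::complex_vector) tensor \<Rightarrow> 'a"
  where "slice_right \<omega> = tensor_lift (\<lambda>a b. \<omega> b *\<^sub>C a)"

definition slice_left :: "('a \<Rightarrow> complex) \<Rightarrow> ('a::complex_vector, 'b::complex_vector) tensor \<Rightarrow> 'b"
  where "slice_left \<omega> = tensor_lift (\<lambda>a b. \<omega> a *\<^sub>C b)"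

text \<open>
  \<open>(id \<otimes> \<omega>)(m)\<close> and \<open>(\<omega> \<otimes> id)(m)\<close> for a multiplier \<open>m\<close> of \<open>A \<otimes> A\<close>, such as \<open>\<Delta>(a)\<close>, whose
  products with \<open>b \<otimes> 1\<close>, respectively \<open>1 \<otimes> b\<close>, lie in \<open>A \<otimes> A\<close>.
\<close>

definition mslice_right ::
  "('a \<Rightarrow> complex) \<Rightarrow> ('a::complex_algebra, 'a) tensor multiplier \<Rightarrow> 'a multiplier"
  where "mslice_right \<omega> m = multiplier
    (\<lambda>b. slice_right \<omega> (inv embed (m * (embed b \<otimes>\<^sub>m 1))))
    (\<lambda>b. slice_right \<omega> (inv embed ((embed b \<otimes>\<^sub>m 1) * m)))"

definition mslice_left ::
  "('a \<Rightarrow> complex) \<Rightarrow> ('a::complex_algebra, 'a) tensor multiplier \<Rightarrow> 'a multiplier"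
  where "mslice_left \<omega> m = multiplier
    (\<lambda>b. slice_left \<omega> (inv embed (m * (1 \<otimes>\<^sub>m embed b))))
    (\<lambda>b. slice_left \<omega> (inv embed ((1 \<otimes>\<^sub>m embed b) * m)))"

definition counit :: "'i set \<Rightarrow> ('i, 'a::complex_algebra) components \<Rightarrow>
    ('a \<Rightarrow> ('a, 'a) tensor multiplier) \<Rightarrow> ('a \<Rightarrow> complex) \<Rightarrow> bool"
  where "counit I C \<Delta> \<epsilon> \<longleftrightarrow> clinear \<epsilon> \<and>
    (\<forall>r\<in>I. \<forall>t\<in>I. \<forall>s\<in>I. \<forall>u\<in>I. r \<noteq> t \<or> s \<noteq> u \<longrightarrow> (\<forall>a\<in>C (r, t) (s, u). \<epsilon> a = 0)) \<and>
    (\<forall>r\<in>I. (\<exists>a\<in>right_low I C r. \<epsilon> a \<noteq> 0) \<and> (\<exists>a\<in>left_low I C r. \<epsilon> a \<noteq> 0)) \<and>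
    (\<forall>s\<in>I. \<forall>t\<in>I. \<forall>a\<in>col_space (I \<times> I) C (s, t). \<forall>b\<in>row_space (I \<times> I) C (s, t).
      \<epsilon> (a * b) = \<epsilon> a * \<epsilon> b) \<and>
    (\<forall>a. mslice_right \<epsilon> (\<Delta> a) = embed a \<and> mslice_left \<epsilon> (\<Delta> a) = embed a)"

definition regular_partial_multiplier_bialgebra :: "'i set \<Rightarrow>
    ('i, 'a::complex_algebra) components \<Rightarrow> ('a \<Rightarrow> ('a, 'a) tensor multiplier) \<Rightarrow> bool"
  where "regular_partial_multiplier_bialgebra I C \<Delta> \<longleftrightarrow>
    nondegenerate_partial_algebra (I \<times> I) C \<and> idempotent_partial_algebra (I \<times> I) C \<and>
    regular_comultiplication I C \<Delta> \<and> (\<exists>\<epsilon>. counit I C \<Delta> \<epsilon>)"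

text \<open>\<open>\<Oplus>\<^sub>r U\<^sub>r \<otimes> V\<^sub>r\<close> inside \<open>A \<otimes> A\<close>.\<close>

definition tensor_sum ::
  "'i set \<Rightarrow> ('i \<Rightarrow> 'a::complex_vector set) \<Rightarrow> ('i \<Rightarrow> 'b::complex_vector set) \<Rightarrow> ('a, 'b) tensor set"
  where "tensor_sum I U V = cvec.span {a \<otimes>\<^sub>t b | a b. \<exists>r\<in>I. a \<in> U r \<and> b \<in> V r}"

definition regular_partial_multiplier_Hopf_algebra :: "'i set \<Rightarrow>
    ('i, 'a::complex_algebra) components \<Rightarrow> ('a \<Rightarrow> ('a, 'a) tensor multiplier) \<Rightarrow> bool"
  where "regular_partial_multiplier_Hopf_algebra I C \<Delta> \<longleftrightarrow>
    regular_partial_multiplier_bialgebra I C \<Delta> \<and>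
    bij_betw (tensor_lift (\<lambda>a b. \<Delta> a * (1 \<otimes>\<^sub>m embed b)))
      (tensor_sum I (right_low I C) (left_low I C))
      (embed ` tensor_sum I (left_low I C) (left_up I C)) \<and>
    bij_betw (tensor_lift (\<lambda>a b. (embed a \<otimes>\<^sub>m 1) * \<Delta> b))
      (tensor_sum I (right_up I C) (left_up I C))
      (embed ` tensor_sum I (right_low I C) (right_up I C)) \<and>
    bij_betw (tensor_lift (\<lambda>a b. mflip (\<Delta> a) * (1 \<otimes>\<^sub>m embed b)))
      (tensor_sum I (right_up I C) (left_up I C))
      (embed ` tensor_sum I (left_up I C) (left_low I C)) \<and>
    bij_betw (tensor_lift (\<lambda>a b. (embed a \<otimes>\<^sub>m 1) * mflip (\<Delta> b)))
      (tensor_sum I (right_low I C) (left_low I C))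
      (embed ` tensor_sum I (right_up I C) (right_low I C))"


section \<open>Star structures, invariant functionals and unitary modules\<close>

definition partial_multiplier_Hopf_star_algebra :: "'i set \<Rightarrow>
    ('i, 'a::complex_star_algebra) components \<Rightarrow> ('a \<Rightarrow> ('a, 'a) tensor multiplier) \<Rightarrow> bool"
  where "partial_multiplier_Hopf_star_algebra I C \<Delta> \<longleftrightarrow>
    regular_partial_multiplier_Hopf_algebra I C \<Delta> \<and>
    (\<forall>p\<in>I \<times> I. \<forall>q\<in>I \<times> I. star ` C p q = C q p) \<and>
    (\<forall>a. \<Delta> (star a) = star (\<Delta> a))"

definition left_invariant :: "'i set \<Rightarrow> ('i, 'a::complex_algebra) components \<Rightarrow>
    ('a \<Rightarrow> ('a, 'a) tensor multiplier) \<Rightarrow> ('a \<Rightarrow> complex) \<Rightarrow> bool"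
  where "left_invariant I C \<Delta> \<phi> \<longleftrightarrow> clinear \<phi> \<and>
    (\<forall>p\<in>I \<times> I. \<forall>q\<in>I \<times> I. p \<noteq> q \<longrightarrow> (\<forall>a\<in>C p q. \<phi> a = 0)) \<and>
    (\<forall>a. mslice_right \<phi> (\<Delta> a) =
      strict_sum I (\<lambda>r. \<phi> (unit_up I C r \<rhd> a) *\<^sub>C unit_up I C r))"

definition faithful_functional :: "('a::complex_algebra \<Rightarrow> complex) \<Rightarrow> bool"
  where "faithful_functional \<phi> \<longleftrightarrow>
    (\<forall>a. (\<forall>b. \<phi> (a * b) = 0) \<or> (\<forall>b. \<phi> (b * a) = 0) \<longrightarrow> a = 0)"

definition positive_functional :: "('a::complex_star_algebra \<Rightarrow> complex) \<Rightarrow> bool"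
  where "positive_functional \<phi> \<longleftrightarrow> (\<forall>a. \<phi> (star a * a) \<in> \<real>\<^sub>\<ge>\<^sub>0)"

definition partial_star_algebraic_quantum_group :: "'i set \<Rightarrow>
    ('i, 'a::complex_star_algebra) components \<Rightarrow> ('a \<Rightarrow> ('a, 'a) tensor multiplier) \<Rightarrow> bool"
  where "partial_star_algebraic_quantum_group I C \<Delta> \<longleftrightarrow>
    partial_multiplier_Hopf_star_algebra I C \<Delta> \<and>
    (\<exists>\<phi>. positive_functional \<phi> \<and> faithful_functional \<phi> \<and> left_invariant I C \<Delta> \<phi>)"

text \<open>Inner products are linear in the second argument.\<close>

definition pre_hilbert :: "('v::complex_vector \<Rightarrow> 'v \<Rightarrow> complex) \<Rightarrow> bool"
  where "pre_hilbert ip \<longleftrightarrow> (\<forall>v. clinear (ip v)) \<and> (\<forall>v w. ip w v = cnj (ip v w)) \<and>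
    (\<forall>v. ip v v \<in> \<real>\<^sub>\<ge>\<^sub>0) \<and> (\<forall>v. ip v v = 0 \<longrightarrow> v = 0)"

definition ip_norm :: "('v \<Rightarrow> 'v \<Rightarrow> complex) \<Rightarrow> 'v \<Rightarrow> real"
  where "ip_norm ip v = sqrt (Re (ip v v))"

definition left_module :: "('a::complex_algebra \<Rightarrow> 'v::complex_vector \<Rightarrow> 'v) \<Rightarrow> bool"
  where "left_module act \<longleftrightarrow> bilinear_map act \<and> (\<forall>a b v. act (a * b) v = act a (act b v))"

definition unitary_module :: "('a::complex_star_algebra \<Rightarrow> 'v::complex_vector \<Rightarrow> 'v) \<Rightarrow>
    ('v \<Rightarrow> 'v \<Rightarrow> complex) \<Rightarrow> bool"
  where "unitary_module act ip \<longleftrightarrow> left_module act \<and>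
    cvec.span {act a v | a v. True} = UNIV \<and> pre_hilbert ip \<and>
    (\<forall>a v w. ip v (act a w) = ip (act (star a) v) w)"

definition bounded_operator :: "('v::complex_vector \<Rightarrow> 'v \<Rightarrow> complex) \<Rightarrow> ('v \<Rightarrow> 'v) \<Rightarrow> bool"
  where "bounded_operator ip T \<longleftrightarrow> clinear T \<and> (\<exists>K. \<forall>v. ip_norm ip (T v) \<le> K * ip_norm ip v)"

end

theory Submission
  imports Defs
begin

text \<open>
  Let \<open>\<phi>\<close> be a positive faithful left invariant functional. Then \<open>\<langle>a, b\<rangle> = \<phi>(a\<^sup>*b)\<close> makes \<open>A\<close> a
  pre-Hilbert space, and so is \<open>V \<otimes> A\<close> (lemma \<open>pre_hilbert_tensor_form\<close>). For \<open>b \<in> A\<close>, the map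
  \<open>av \<mapsto> \<Delta>(b)(a \<otimes> 1)(v \<otimes> -)\<close> from \<open>V = AV\<close> to \<open>V \<otimes> A\<close> plays the role of a column of the unitary
  corepresentation attached to \<open>V\<close>: if \<open>b\<close> is homogeneous with right upper index \<open>r\<close>, left invariance gives
  \<open>(id \<otimes> \<phi>)(\<Delta>(b\<^sup>*b)) = \<phi>(b\<^sup>*b)\<^bold>1\<^sup>r\<close>, so that the squared norm of the image of \<open>v\<close> is
  \<open>\<phi>(b\<^sup>*b)\<parallel>\<^bold>1\<^sup>rv\<parallel>\<^sup>2 \<le> \<phi>(b\<^sup>*b)\<parallel>v\<parallel>\<^sup>2\<close> (lemmas \<open>tensor_form_can_map\<close> and \<open>unit_act_contraction\<close>).

  Slicing the second leg with \<open>\<phi>(a -) = \<langle>a\<^sup>*, -\<rangle>\<close> is bounded by the Cauchy--Schwarz inequality in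
  \<open>V \<otimes> A\<close> (lemma \<open>slice_bounded\<close>). Hence every element \<open>(id \<otimes> \<phi>)((1 \<otimes> a)\<Delta>(b))\<close> of \<open>A\<close> acts by a
  bounded operator. These elements span \<open>A\<close> (lemma \<open>slices_span\<close>): by surjectivity of a canonical map
  the elements \<open>(1 \<otimes> a)\<Delta>(b)\<close> span a space containing \<open>A\<^sub>r \<otimes> A\<^sup>r\<close> for every \<open>r\<close>, and \<open>\<phi>\<close> does not vanish
  on \<open>A\<^sup>r\<close>, which is nonzero by the properties of the counit.
\<close>

section \<open>Tensor products of pre-Hilbert spaces\<close>

lemma pre_hilbertD:
  assumes "pre_hilbert ip"
  shows "ip v (w + w') = ip v w + ip v w'" "ip v (c *\<^sub>C w) = c * ip v w"
    "ip (v + v') w = ip v w + ip v' w" "ip (c *\<^sub>C v) w = cnj c * ip v w"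
    "cnj (ip v w) = ip w v" "ip v v = complex_of_real (Re (ip v v))" "0 \<le> Re (ip v v)"
    "ip v v = 0 \<Longrightarrow> v = 0" "ip v v \<in> \<real>\<^sub>\<ge>\<^sub>0"
proof -
  have lin: "clinear (ip v)" for v using assms unfolding pre_hilbert_def by blast
  have sym: "ip w v = cnj (ip v w)" for v w using assms unfolding pre_hilbert_def by blast
  have nn: "ip v v \<in> \<real>\<^sub>\<ge>\<^sub>0" using assms unfolding pre_hilbert_def by blast
  show "cnj (ip v w) = ip w v" using sym[of w v] by simp
  show add: "ip v (w + w') = ip v w + ip v w'" for v w w'
    by (rule clinear_add[OF lin])
  show scale: "ip v (c *\<^sub>C w) = c * ip v w" for v w c
    using clinear_scaleC[OF lin, of v c w] by (simp add: scaleC_complex_def)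
  show "ip (v + v') w = ip v w + ip v' w"
    unfolding sym[of "v + v'" w] sym[of v w] sym[of v' w] add by simp
  show "ip (c *\<^sub>C v) w = cnj c * ip v w"
    unfolding sym[of "c *\<^sub>C v" w] sym[of v w] scale by simp
  show "ip v v \<in> \<real>\<^sub>\<ge>\<^sub>0" by (rule nn)
  show "ip v v = complex_of_real (Re (ip v v))" "0 \<le> Re (ip v v)"
    using nn by (auto simp: complex_nonneg_Reals_iff complex_eq_iff)
  show "ip v v = 0 \<Longrightarrow> v = 0" using assms unfolding pre_hilbert_def by blast
qed

lemma pre_hilbert_zero:
  assumes "pre_hilbert ip"
  shows "ip v 0 = 0" "ip 0 v = 0"
  using pre_hilbertD(2)[OF assms, of v 0 v] pre_hilbertD(4)[OF assms, of 0 v v] by simp_all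

lemma pre_hilbert_diff:
  assumes "pre_hilbert ip"
  shows "ip v (w - w') = ip v w - ip v w'" "ip (v - v') w = ip v w - ip v' w"
  using pre_hilbertD(1)[OF assms, of v "w - w'" w'] pre_hilbertD(3)[OF assms, of "v - v'" v' w]
  by (simp_all add: eq_diff_eq)

lemma pre_hilbert_Cauchy_Schwarz:
  assumes "pre_hilbert ip"
  shows "(cmod (ip v w))\<^sup>2 \<le> Re (ip v v) * Re (ip w w)"
proof (cases "v = 0")
  case True
  then show ?thesis by (simp add: pre_hilbert_zero[OF assms])
next
  case False
  note ip = pre_hilbertD[OF assms] pre_hilbert_diff[OF assms]
  define n where "n = Re (ip v v)"
  have n1: "ip v v = complex_of_real n"
    unfolding n_def by (rule ip(6))
  have n2: "n > 0"
  proof -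
    have "n \<noteq> 0" using ip(8)[of v] False n1 by auto
    then show ?thesis using ip(7)[of v] by (simp add: n_def order_less_le)
  qed
  define u where "u = n *\<^sub>C w - ip v w *\<^sub>C v"
  have "ip u u = n * (n * ip w w - ip v w * cnj (ip v w))"
    unfolding u_def by (simp add: ip(1-4,10,11) ip(5)[of v w, symmetric] n1 algebra_simps)
  then have "0 \<le> Re (n * (n * ip w w - ip v w * cnj (ip v w)))"
    using ip(7)[of u] by simp
  also have "Re (n * (n * ip w w - ip v w * cnj (ip v w))) = n * (n * Re (ip w w) - (cmod (ip v w))\<^sup>2)"
    unfolding complex_norm_square[symmetric] by simp
  finally show ?thesis
    using n2 by (simp add: zero_le_mult_iff n_def)
qed

text \<open>The sesquilinear form on \<open>V \<otimes> W\<close> with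
  \<open>\<langle>v \<otimes> w, v' \<otimes> w'\<rangle> = \<langle>v, v'\<rangle>\<langle>w, w'\<rangle>\<close>, conjugate-linear in the first argument.\<close>

definition tensor_form :: "('v::complex_vector \<Rightarrow> 'v \<Rightarrow> complex) \<Rightarrow>
    ('w::complex_vector \<Rightarrow> 'w \<Rightarrow> complex) \<Rightarrow> ('v, 'w) tensor \<Rightarrow> ('v, 'w) tensor \<Rightarrow> complex"
  where "tensor_form ip ip' s t =
    tensor_semilift cnj (\<lambda>v w. tensor_lift (\<lambda>v' w'. ip v v' * ip' w w') t) s"

context
  fixes ip :: "'v::complex_vector \<Rightarrow> 'v \<Rightarrow> complex" and ip' :: "'w::complex_vector \<Rightarrow> 'w \<Rightarrow> complex"
  assumes H: "pre_hilbert ip" and H': "pre_hilbert ip'"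
begin

lemma bilinear_form_product: "bilinear_map (\<lambda>v' w'. ip v v' * ip' w w')"
  by (simp add: semi_bilinear_def pre_hilbertD(1-5)[OF H] pre_hilbertD(1-5)[OF H'] scaleC_complex_def
      algebra_simps)

lemma semi_bilinear_form_product:
  "semi_bilinear cnj (\<lambda>v w. tensor_lift (\<lambda>v' w'. ip v v' * ip' w w') t)"
proof (induction t)
  case (tens v' w')
  have "tensor_lift (\<lambda>v' w'. ip v v' * ip' w w') (v' \<otimes>\<^sub>t w') = ip v v' * ip' w w'" for v w
    by (rule tensor_semilift_tens[OF bilinear_form_product])
  then show ?case
    by (simp add: semi_bilinear_def pre_hilbertD(1-5)[OF H] pre_hilbertD(1-5)[OF H']
        scaleC_complex_def algebra_simps)
next
  case (add s t)
  then show ?case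
    unfolding tensor_semilift_add[OF bilinear_form_product] semi_bilinear_def
    by (simp add: scaleC_add_right ac_simps)
qed

lemma tensor_form_tens: "tensor_form ip ip' (v \<otimes>\<^sub>t w) (v' \<otimes>\<^sub>t w') = ip v v' * ip' w w'"
  unfolding tensor_form_def tensor_semilift_tens[OF semi_bilinear_form_product]
  by (rule tensor_semilift_tens[OF bilinear_form_product])

lemma tensor_form_add_left: "tensor_form ip ip' (s + s') t = tensor_form ip ip' s t + tensor_form ip ip' s' t"
  by (simp add: tensor_form_def tensor_semilift_add semi_bilinear_form_product)

lemma tensor_form_linear_right: "clinear (tensor_form ip ip' s)"
proof (induction s)
  case (tens v w)
  have "tensor_form ip ip' (v \<otimes>\<^sub>t w) = tensor_lift (\<lambda>v' w'. ip v v' * ip' w w')"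
    by (rule ext) (simp add: tensor_form_def semi_bilinear_form_product)
  then show ?case by (simp add: clinear_tensor_lift bilinear_form_product)
next
  case (add s s')
  then show ?case by (simp add: clinear_iff tensor_form_add_left scaleC_add_right)
qed

lemma tensor_form_sym: "tensor_form ip ip' t s = cnj (tensor_form ip ip' s t)"
proof (induction s)
  case (tens v w)
  show ?case
    by (induction t)
      (simp_all add: tensor_form_tens tensor_form_add_left clinear_add[OF tensor_form_linear_right]
        pre_hilbertD(5)[OF H] pre_hilbertD(5)[OF H'])
qed (simp add: tensor_form_add_left clinear_add[OF tensor_form_linear_right])

text \<open>The induction is on the number of elementary tensors \<open>v\<^sub>i \<otimes> w\<^sub>i\<close> with sum \<open>z\<close>: splitting
  each \<open>v\<^sub>i\<close> into a multiple of \<open>v\<^sub>0\<close> and a vector orthogonal to \<open>v\<^sub>0\<close> writes \<open>z\<close> as an orthogonal sum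
  of \<open>v\<^sub>0 \<otimes> y\<close> and a tensor with one term less.\<close>

lemma tensor_form_definite_list:
  fixes xs :: "('v \<times> 'w) list"
  defines "z \<equiv> (\<Sum>(v, w)\<leftarrow>xs. v \<otimes>\<^sub>t w)"
  shows "tensor_form ip ip' z z \<in> \<real>\<^sub>\<ge>\<^sub>0 \<and> (tensor_form ip ip' z z = 0 \<longrightarrow> z = 0)"
  unfolding z_def
proof (induction xs rule: length_induct)
  case (1 xs)
  let ?B = "tensor_form ip ip'"
  have zero: "?B 0 0 = 0"
    using clinear_scaleC[OF tensor_form_linear_right, of 0 0 0] by simp
  show ?case
  proof (cases xs)
    case Nil
    then show ?thesis by (simp add: zero)
  next
    case (Cons x ys)
    obtain v0 w0 where x: "x = (v0, w0)" by fastforce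
    have IH: "?B z z \<in> \<real>\<^sub>\<ge>\<^sub>0 \<and> (?B z z = 0 \<longrightarrow> z = 0)"
      if "z = (\<Sum>(v, w)\<leftarrow>zs. v \<otimes>\<^sub>t w)" "length zs = length ys" for zs z
      using 1 that Cons by auto
    show ?thesis
    proof (cases "v0 = 0")
      case True
      have "v0 \<otimes>\<^sub>t w0 = 0" using tens_scaleC_left[of 0 v0 w0] True by simp
      then show ?thesis using IH[of _ ys] Cons x by simp
    next
      case False
      note ip = pre_hilbertD[OF H]
      define n where "n = ip v0 v0"
      have n: "n \<noteq> 0" using ip(8)[of v0] False by (auto simp: n_def)
      define \<alpha> where "\<alpha> v = ip v0 v / n" for v
      define p where "p v = v - \<alpha> v *\<^sub>C v0" for v
      have orth: "ip v0 (p v) = 0" for v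
        using n by (simp add: p_def \<alpha>_def pre_hilbert_diff[OF H] ip(2) n_def)
      define z' where "z' zs = (\<Sum>(v, w)\<leftarrow>map (\<lambda>(v, w). (p v, w)) zs. v \<otimes>\<^sub>t w)" for zs :: "('v \<times> 'w) list"
      define y' where "y' zs = (\<Sum>(v, w)\<leftarrow>zs. \<alpha> v *\<^sub>C w)" for zs :: "('v \<times> 'w) list"
      have split: "(\<Sum>(v, w)\<leftarrow>zs. v \<otimes>\<^sub>t w) = z' zs + v0 \<otimes>\<^sub>t y' zs" for zs
      proof (induction zs)
        case Nil
        show ?case using tens_scaleC_right[of v0 0 0] by (simp add: z'_def y'_def)
      next
        case (Cons z zs)
        obtain v w where z: "z = (v, w)" by fastforce
        have "v \<otimes>\<^sub>t w = (p v + \<alpha> v *\<^sub>C v0) \<otimes>\<^sub>t w" by (simp add: p_def)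
        then have "v \<otimes>\<^sub>t w = p v \<otimes>\<^sub>t w + v0 \<otimes>\<^sub>t (\<alpha> v *\<^sub>C w)"
          by (simp only: tens_add_left tens_scaleC_left tens_scaleC_right)
        then show ?case using Cons by (simp add: z z'_def y'_def tens_add_right)
      qed
      have orth': "?B (v0 \<otimes>\<^sub>t y) (z' zs) = 0" for y zs
      proof (induction zs)
        case Nil
        show ?case using clinear_scaleC[OF tensor_form_linear_right, of "v0 \<otimes>\<^sub>t y" 0 0]
          by (simp add: z'_def)
      next
        case (Cons z zs)
        then show ?case
          by (cases z) (simp add: z'_def clinear_add[OF tensor_form_linear_right] tensor_form_tens orth)
      qed
      define y where "y = w0 + y' ys"
      have z: "(\<Sum>(v, w)\<leftarrow>xs. v \<otimes>\<^sub>t w) = v0 \<otimes>\<^sub>t y + z' ys"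
        by (simp add: Cons x split y_def tens_add_right)
      have B: "?B (v0 \<otimes>\<^sub>t y + z' ys) (v0 \<otimes>\<^sub>t y + z' ys) = ip v0 v0 * ip' y y + ?B (z' ys) (z' ys)"
        using orth'[of y ys] tensor_form_sym[of "z' ys" "v0 \<otimes>\<^sub>t y"]
        by (simp add: tensor_form_add_left clinear_add[OF tensor_form_linear_right] tensor_form_tens)
      have IH': "?B (z' ys) (z' ys) \<in> \<real>\<^sub>\<ge>\<^sub>0 \<and> (?B (z' ys) (z' ys) = 0 \<longrightarrow> z' ys = 0)"
        by (rule IH[of _ "map (\<lambda>(v, w). (p v, w)) ys"]) (simp_all add: z'_def)
      have nn: "ip v0 v0 * ip' y y \<in> \<real>\<^sub>\<ge>\<^sub>0"
        by (intro nonneg_Reals_mult_I pre_hilbertD(9)[OF H] pre_hilbertD(9)[OF H'])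
      have "y = 0 \<and> z' ys = 0" if "ip v0 v0 * ip' y y + ?B (z' ys) (z' ys) = 0"
      proof -
        have "ip v0 v0 * ip' y y = 0 \<and> ?B (z' ys) (z' ys) = 0"
          using that nn IH' by (auto simp: complex_nonneg_Reals_iff complex_eq_iff)
        then show ?thesis using IH' n pre_hilbertD(8)[OF H'] by (simp add: n_def)
      qed
      moreover have "v0 \<otimes>\<^sub>t 0 = (0 :: ('v, 'w) tensor)" using tens_scaleC_right[of v0 0 0] by simp
      ultimately show ?thesis
        unfolding z B using nn IH' by (auto intro: nonneg_Reals_add_I)
    qed
  qed
qed

lemma pre_hilbert_tensor_form: "pre_hilbert (tensor_form ip ip')"
proof -
  have "\<exists>xs. z = (\<Sum>(v, w)\<leftarrow>xs. v \<otimes>\<^sub>t w)" for z :: "('v, 'w) tensor"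
  proof (induction z)
    case (tens a b)
    have "a \<otimes>\<^sub>t b = (\<Sum>(v, w)\<leftarrow>[(a, b)]. v \<otimes>\<^sub>t w)" by simp
    then show ?case by blast
  next
    case (add s t)
    then obtain xs ys where "s = (\<Sum>(v, w)\<leftarrow>xs. v \<otimes>\<^sub>t w)" "t = (\<Sum>(v, w)\<leftarrow>ys. v \<otimes>\<^sub>t w)" by blast
    then have "s + t = (\<Sum>(v, w)\<leftarrow>xs @ ys. v \<otimes>\<^sub>t w)" by simp
    then show ?case by blast
  qed
  then have definite: "tensor_form ip ip' z z \<in> \<real>\<^sub>\<ge>\<^sub>0 \<and> (tensor_form ip ip' z z = 0 \<longrightarrow> z = 0)" for z
    using tensor_form_definite_list by metis
  show ?thesis
    unfolding pre_hilbert_def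
    by (intro conjI allI tensor_form_linear_right tensor_form_sym) (simp_all add: definite)
qed

text \<open>Cauchy--Schwarz for \<open>z\<close> and \<open>h \<otimes> c\<close>, where \<open>h\<close> is the slice of \<open>z\<close>: their inner product
  is \<open>\<langle>h, h\<rangle>\<close>.\<close>

lemma slice_bounded:
  defines "S c \<equiv> slice_right (ip' c)"
  shows "Re (ip (S c z) (S c z)) \<le> Re (ip' c c) * Re (tensor_form ip ip' z z)"
proof -
  have bil: "bilinear_map (\<lambda>v w. ip' c w *\<^sub>C v)"
    by (simp add: semi_bilinear_def pre_hilbertD(1-5)[OF H'] scaleC_add_right scaleC_add_left
        scaleC_scaleC mult.commute)
  define h where "h = S c z"
  have "tensor_form ip ip' (h \<otimes>\<^sub>t c) t = ip h (S c t)" for t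
    by (induction t)
      (simp_all add: S_def slice_right_def bil tensor_semilift_add tensor_form_tens
        clinear_add[OF tensor_form_linear_right] pre_hilbertD(1,2)[OF H] mult.commute)
  then have CS: "(cmod (ip h h))\<^sup>2 \<le> Re (ip h h * ip' c c) * Re (tensor_form ip ip' z z)"
    using pre_hilbert_Cauchy_Schwarz[OF pre_hilbert_tensor_form, of "h \<otimes>\<^sub>t c" z]
    by (simp add: h_def tensor_form_tens)
  have im: "Im (ip h h) = 0"
    using pre_hilbertD(6)[OF H, of h] by (metis Im_complex_of_real)
  have le: "Re (ip h h) * Re (ip h h) \<le> Re (ip h h) * (Re (ip' c c) * Re (tensor_form ip ip' z z))"
    using CS by (simp add: cmod_def im power2_eq_square)
  have "0 \<le> Re (ip' c c) * Re (tensor_form ip ip' z z)"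
    by (intro mult_nonneg_nonneg pre_hilbertD(7)[OF H'] pre_hilbertD(7)[OF pre_hilbert_tensor_form])
  then show ?thesis
    using le pre_hilbertD(7)[OF H, of h] by (cases "Re (ip h h) = 0") (auto simp: h_def)
qed

end


section \<open>Multipliers and tensor products\<close>

lemma embed_act [simp]: "embed a \<rhd> b = a * b" "b \<lhd> embed a = b * a"
  by (transfer; simp)+

lemma mult_act [simp]: "(m * n) \<rhd> a = m \<rhd> n \<rhd> a" "a \<lhd> (m * n) = a \<lhd> m \<lhd> n"
  by (transfer; simp)+

lemma one_act [simp]: "1 \<rhd> a = a" "a \<lhd> 1 = a"
  by (transfer; simp)+

lemma add_act [simp]: "(m + n) \<rhd> a = m \<rhd> a + n \<rhd> a" "a \<lhd> (m + n) = a \<lhd> m + a \<lhd> n"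
  by (transfer; simp)+

lemma zero_act [simp]: "0 \<rhd> a = 0" "a \<lhd> 0 = 0"
  by (transfer; simp)+

lemma scaleC_act [simp]: "(c *\<^sub>C m) \<rhd> a = c *\<^sub>C (m \<rhd> a)" "a \<lhd> (c *\<^sub>C m) = c *\<^sub>C (a \<lhd> m)"
  by (transfer; simp)+

lemma star_act: "star m \<rhd> a = star (star a \<lhd> m)" "a \<lhd> star m = star (m \<rhd> star a)"
  by (transfer; simp)+

lemma sum_act: "sum f F \<rhd> a = (\<Sum>x\<in>F. f x \<rhd> a)" "a \<lhd> sum f F = (\<Sum>x\<in>F. a \<lhd> f x)"
  by (induction F rule: infinite_finite_induct) simp_all

lemma act_add: "m \<rhd> (a + b) = m \<rhd> a + m \<rhd> b" "(a + b) \<lhd> m = a \<lhd> m + b \<lhd> m"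
  using clinear_lact[of m] clinear_ract[of m] by (simp_all add: clinear_iff)

lemma clinear_ident: "clinear (\<lambda>v. v)"
  unfolding clinear_iff by (intro conjI allI refl)

lemma clinear_comp: "clinear f \<Longrightarrow> clinear g \<Longrightarrow> clinear (\<lambda>x. f (g x))"
  by (simp add: clinear_iff)

lemma clinear_zero: "clinear f \<Longrightarrow> f 0 = 0"
  by (drule clinear_scaleC[of f 0 0]) simp

lemma clinear_diff: "clinear f \<Longrightarrow> f (a - b) = f a - f b"
  by (drule clinear_add[of f "a - b" b]) simp

lemma act_zero [simp]: "m \<rhd> 0 = 0" "0 \<lhd> m = 0"
  by (simp_all add: clinear_zero[OF clinear_lact] clinear_zero[OF clinear_ract])

lemma embed_mult: "embed (a * b) = embed a * embed b"
  by (rule multiplier_eqI) (simp_all add: mult.assoc)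

lemma embed_add: "embed (a + b) = embed a + embed b"
  by (rule multiplier_eqI) (simp_all add: distrib_left distrib_right)

lemma embed_scaleC: "embed (c *\<^sub>C a) = c *\<^sub>C embed a"
  by (rule multiplier_eqI) (simp_all add: mult_scaleC_left mult_scaleC_right)

lemma embed_star: "embed (star a) = star (embed a)"
  by (rule multiplier_eqI) (simp_all add: star_act star_mult star_star)

lemma star_zero: "star 0 = (0 :: 'a::complex_star_algebra)"
  using star_add[of "0 :: 'a" 0] by simp

lemma star_one_multiplier: "star 1 = (1 :: 'a::complex_star_algebra multiplier)"
  by (rule multiplier_eqI) (simp_all add: star_act star_star)

lemma mtens_act [simp]:
  "(m \<otimes>\<^sub>m n) \<rhd> (a \<otimes>\<^sub>t b) = (m \<rhd> a) \<otimes>\<^sub>t (n \<rhd> b)" "(a \<otimes>\<^sub>t b) \<lhd> (m \<otimes>\<^sub>m n) = (a \<lhd> m) \<otimes>\<^sub>t (b \<lhd> n)"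
  using clinear_lact[of m] clinear_lact[of n] clinear_ract[of m] clinear_ract[of n]
  by (simp_all add: lact.rep_eq ract.rep_eq mtens.rep_eq)

lemma multiplier_tensor_eqI:
  assumes "\<And>a b. m \<rhd> (a \<otimes>\<^sub>t b) = n \<rhd> (a \<otimes>\<^sub>t b)" "\<And>a b. (a \<otimes>\<^sub>t b) \<lhd> m = (a \<otimes>\<^sub>t b) \<lhd> n"
  shows "m = n"
proof (rule multiplier_eqI)
  show "m \<rhd> t = n \<rhd> t" for t by (induction t) (simp_all add: assms act_add)
  show "t \<lhd> m = t \<lhd> n" for t by (induction t) (simp_all add: assms act_add)
qed

lemma mtens_add:
  "(m + m') \<otimes>\<^sub>m n = m \<otimes>\<^sub>m n + m' \<otimes>\<^sub>m n" "m \<otimes>\<^sub>m (n + n') = m \<otimes>\<^sub>m n + m \<otimes>\<^sub>m n'"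
  by (rule multiplier_tensor_eqI; simp add: tens_add_left tens_add_right)+

lemma mtens_scaleC: "(c *\<^sub>C m) \<otimes>\<^sub>m n = c *\<^sub>C (m \<otimes>\<^sub>m n)" "m \<otimes>\<^sub>m (c *\<^sub>C n) = c *\<^sub>C (m \<otimes>\<^sub>m n)"
  by (rule multiplier_tensor_eqI; simp add: tens_scaleC_left tens_scaleC_right)+

lemma embed_tens: "embed (a \<otimes>\<^sub>t b) = embed a \<otimes>\<^sub>m embed b"
  by (rule multiplier_tensor_eqI) simp_all

lemma star_tens: "star (a \<otimes>\<^sub>t b) = star a \<otimes>\<^sub>t star b"
proof -
  have "semi_bilinear cnj (\<lambda>(a::'a::complex_star_algebra) (b::'b::complex_star_algebra). star a \<otimes>\<^sub>t star b)"
    by (simp add: semi_bilinear_def star_add star_scaleC tens_add_left tens_add_right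
        tens_scaleC_left tens_scaleC_right)
  then show ?thesis by (simp add: star_tensor_def)
qed

lemma star_mtens: "star (m \<otimes>\<^sub>m n) = star m \<otimes>\<^sub>m star n"
  by (rule multiplier_tensor_eqI) (simp_all add: star_act star_tens)

lemma mflip_act: "mflip m \<rhd> t = flip (m \<rhd> flip t)" "t \<lhd> mflip m = flip (flip t \<lhd> m)"
  by (simp_all add: lact.rep_eq ract.rep_eq mflip.rep_eq)

lemma mflip_mult: "mflip (m * n) = mflip m * mflip n"
  by (rule multiplier_eqI) (simp_all add: mflip_act)

lemma mflip_mflip: "mflip (mflip m) = m"
  by (rule multiplier_eqI) (simp_all add: mflip_act)

lemma mflip_mtens: "mflip (m \<otimes>\<^sub>m n) = n \<otimes>\<^sub>m m"
  by (rule multiplier_tensor_eqI) (simp_all add: mflip_act)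

lemma mflip_add: "mflip (m + n) = mflip m + mflip n"
  by (rule multiplier_eqI) (simp_all add: mflip_act clinear_add[OF clinear_flip])

lemma mflip_scaleC: "mflip (c *\<^sub>C m) = c *\<^sub>C mflip m"
  by (rule multiplier_eqI) (simp_all add: mflip_act clinear_scaleC[OF clinear_flip])

text \<open>In a non-degenerate algebra the two maps of a multiplier are automatically
  module maps.\<close>

lemma lact_mult_right:
  fixes a b :: "'a::complex_algebra"
  assumes "\<And>x :: 'a. (\<And>c. c * x = 0) \<Longrightarrow> x = 0"
  shows "m \<rhd> (a * b) = (m \<rhd> a) * b"
proof -
  have "c * (m \<rhd> (a * b) - (m \<rhd> a) * b) = 0" for c
    by (simp add: right_diff_distrib multiplier_compat mult.assoc[symmetric])
  then show ?thesis using assms[of "m \<rhd> (a * b) - (m \<rhd> a) * b"] by simp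
qed

lemma ract_mult_left:
  fixes a b :: "'a::complex_algebra"
  assumes "\<And>x :: 'a. (\<And>c. x * c = 0) \<Longrightarrow> x = 0"
  shows "(a * b) \<lhd> m = a * (b \<lhd> m)"
proof -
  have "((a * b) \<lhd> m - a * (b \<lhd> m)) * c = 0" for c
    by (simp add: left_diff_distrib mult.assoc multiplier_compat[symmetric])
  then show ?thesis using assms[of "(a * b) \<lhd> m - a * (b \<lhd> m)"] by simp
qed

lemma bilinear_slice_right: "clinear \<omega> \<Longrightarrow> bilinear_map (\<lambda>a b. \<omega> b *\<^sub>C a)"
  by (simp add: semi_bilinear_def clinear_iff scaleC_add_left scaleC_add_right scaleC_scaleC
      scaleC_complex_def mult.commute)

lemma slice_right_tens: "clinear \<omega> \<Longrightarrow> slice_right \<omega> (a \<otimes>\<^sub>t b) = \<omega> b *\<^sub>C a"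
  by (simp add: slice_right_def bilinear_slice_right)

lemma clinear_slice_right: "clinear \<omega> \<Longrightarrow> clinear (slice_right \<omega>)"
  by (simp add: slice_right_def bilinear_slice_right clinear_tensor_lift)

lemma slice_right_mtens_act:
  assumes "clinear \<omega>"
  shows "slice_right \<omega> ((embed a \<otimes>\<^sub>m 1) \<rhd> t) = a * slice_right \<omega> t"
    "slice_right \<omega> (t \<lhd> (embed a \<otimes>\<^sub>m 1)) = slice_right \<omega> t * a"
    "slice_right \<omega> ((1 \<otimes>\<^sub>m embed c) \<rhd> t) = slice_right (\<lambda>b. \<omega> (c * b)) t"
proof -
  have lin: "clinear (\<lambda>b. \<omega> (c * b))"
    using assms by (simp add: clinear_iff distrib_left mult_scaleC_right)
  note simps = slice_right_tens[OF assms] slice_right_tens[OF lin] clinear_add[OF clinear_slice_right[OF assms]]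
    clinear_add[OF clinear_slice_right[OF lin]]
    mult_scaleC_left mult_scaleC_right distrib_left distrib_right act_add
  show "slice_right \<omega> ((embed a \<otimes>\<^sub>m 1) \<rhd> t) = a * slice_right \<omega> t"
    by (induction t) (simp_all add: simps)
  show "slice_right \<omega> (t \<lhd> (embed a \<otimes>\<^sub>m 1)) = slice_right \<omega> t * a"
    by (induction t) (simp_all add: simps)
  show "slice_right \<omega> ((1 \<otimes>\<^sub>m embed c) \<rhd> t) = slice_right (\<lambda>b. \<omega> (c * b)) t"
    by (induction t) (simp_all add: simps)
qed


section \<open>Faithful positive functionals\<close>

lemma pre_hilbert_faithful_positive:
  fixes \<phi> :: "'a::complex_star_algebra \<Rightarrow> complex"
  assumes lin: "clinear \<phi>" and pos: "positive_functional \<phi>" and faith: "faithful_functional \<phi>"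
  shows "pre_hilbert (\<lambda>a b. \<phi> (star a * b))"
proof -
  note add = clinear_add[OF lin]
  have scale: "\<phi> (c *\<^sub>C a) = c * \<phi> a" for c a
    using clinear_scaleC[OF lin, of c a] by (simp add: scaleC_complex_def)
  have nn: "\<phi> (star a * a) \<in> \<real>\<^sub>\<ge>\<^sub>0" for a
    using pos by (simp add: positive_functional_def)
  have im: "Im (\<phi> (star a * a)) = 0" for a
    using nn[of a] by (auto simp: complex_nonneg_Reals_iff)
  \<comment> \<open>Polarisation: a sesquilinear form that is real on the diagonal is Hermitian.\<close>
  have sym: "\<phi> (star b * a) = cnj (\<phi> (star a * b))" for a b
  proof (rule complex_eqI)
    show "Im (\<phi> (star b * a)) = Im (cnj (\<phi> (star a * b)))"
      using im[of "a + b"] im[of a] im[of b] by (simp add: star_add distrib_left distrib_right add)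
    show "Re (\<phi> (star b * a)) = Re (cnj (\<phi> (star a * b)))"
      using im[of "a + \<i> *\<^sub>C b"] im[of a] im[of b]
      by (simp add: star_add star_scaleC distrib_left distrib_right left_diff_distrib add scale
          clinear_diff[OF lin] mult_scaleC_left mult_scaleC_right)
  qed
  have definite: "a = 0" if a: "\<phi> (star a * a) = 0" for a
  proof -
    have "\<phi> (star b * a) = 0" for b
    proof (rule ccontr)
      assume "\<phi> (star b * a) \<noteq> 0"
      define z where "z = \<phi> (star b * a)"
      define n where "n = Re (\<phi> (star b * b))"
      have n: "n \<ge> 0" using nn[of b] by (simp add: n_def complex_nonneg_Reals_iff)
      \<comment> \<open>This choice gives \<open>kz = - (n + 1)\<close>, so that \<open>\<langle>b + ka, b + ka\<rangle> = n - 2(n + 1) < 0\<close>.\<close>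
      define k :: complex where "k = - complex_of_real ((n + 1) / (cmod z)\<^sup>2) * cnj z"
      have "(cmod z)\<^sup>2 > 0" using \<open>\<phi> (star b * a) \<noteq> 0\<close> by (simp add: z_def)
      have "\<phi> (star (b + k *\<^sub>C a) * (b + k *\<^sub>C a)) = \<phi> (star b * b) + k * z + cnj (k * z)"
        by (simp add: star_add star_scaleC distrib_left distrib_right add scale
            mult_scaleC_left mult_scaleC_right a z_def sym[of a b])
      moreover have "k * z = - complex_of_real (n + 1)"
      proof -
        have "k * z = - complex_of_real ((n + 1) / (cmod z)\<^sup>2) * (z * cnj z)" by (simp add: k_def)
        also have "z * cnj z = complex_of_real ((cmod z)\<^sup>2)" by (simp only: complex_norm_square)
        finally show ?thesis
          using \<open>(cmod z)\<^sup>2 > 0\<close> by (simp flip: of_real_mult of_real_minus of_real_divide of_real_power)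
      qed
      ultimately have "Re (\<phi> (star (b + k *\<^sub>C a) * (b + k *\<^sub>C a))) = n - 2 * (n + 1)"
        by (simp add: n_def)
      then show False using nn[of "b + k *\<^sub>C a"] n by (auto simp: complex_nonneg_Reals_iff)
    qed
    then have "\<forall>b. \<phi> (b * a) = 0" by (metis star_star)
    then show "a = 0" using faith unfolding faithful_functional_def by blast
  qed
  have lin': "clinear (\<lambda>b. \<phi> (star a * b))" for a
    using lin by (simp add: clinear_iff distrib_left mult_scaleC_right)
  show ?thesis
    unfolding pre_hilbert_def by (intro conjI allI impI lin' sym nn definite)
qed

text \<open>The form \<open>\<langle>s, t\<rangle> = (\<phi> \<otimes> \<phi>)(s\<^sup>*t)\<close> on \<open>A \<otimes> A\<close> is definite, so \<open>s\<^sup>*s = 0\<close> forces \<open>s = 0\<close>.\<close>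

lemma nondegenerate_tensor:
  fixes \<phi> :: "'a::complex_star_algebra \<Rightarrow> complex" and s :: "('a, 'a) tensor"
  assumes lin: "clinear \<phi>" and H: "pre_hilbert (\<lambda>a b. \<phi> (star a * b))"
  shows "(\<And>t. s * t = 0) \<Longrightarrow> s = 0" and "(\<And>t. t * s = 0) \<Longrightarrow> s = 0"
proof -
  let ?B = "tensor_form (\<lambda>a b. \<phi> (star a * b)) (\<lambda>a b. \<phi> (star a * b))"
  let ?\<psi> = "tensor_lift (\<lambda>a b. \<phi> a * \<phi> b)"
  have bil: "bilinear_map (\<lambda>a b. \<phi> a * \<phi> b)"
    using lin by (simp add: semi_bilinear_def clinear_iff scaleC_complex_def algebra_simps)
  have B: "?B s t = ?\<psi> (star s * t)" for s t
  proof (induction s)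
    case (tens a b)
    show ?case
      by (induction t) (simp_all add: tensor_form_tens[OF H H] star_tens bil distrib_left
          tensor_semilift_add clinear_add[OF tensor_form_linear_right[OF H H]])
  qed (simp add: tensor_form_add_left[OF H H] star_add bil distrib_right tensor_semilift_add)
  have zero: "s = 0" if "star s * s = 0" for s :: "('a, 'a) tensor"
    using B[of s s] that clinear_zero[OF clinear_tensor_lift[OF bil]]
      pre_hilbertD(8)[OF pre_hilbert_tensor_form[OF H H], of s] by simp
  show "(\<And>t. t * s = 0) \<Longrightarrow> s = 0" using zero by blast
  show "s = 0" if "\<And>t. s * t = 0"
    using zero[of "star s"] that[of "star s"] star_star[of s] by (simp add: star_star star_zero)
qed


section \<open>Direct sums and base units\<close>

lemma component_induct:
  assumes "is_direct_sum K U" and "P 0" and "\<And>k a. k \<in> K \<Longrightarrow> a \<in> U k \<Longrightarrow> P a"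
    and "\<And>a b. P a \<Longrightarrow> P b \<Longrightarrow> P (a + b)"
  shows "P a"
proof -
  obtain c where c: "\<And>k. k \<in> K \<Longrightarrow> c k \<in> U k" "\<And>k. k \<notin> K \<Longrightarrow> c k = 0"
    and a: "a = (\<Sum>k | c k \<noteq> 0. c k)"
    using assms(1) unfolding is_direct_sum_def by metis
  have "P (\<Sum>k\<in>F. c k)" for F
    by (induction F rule: infinite_finite_induct) (use assms c in \<open>auto, metis\<close>)
  then show ?thesis by (simp add: a)
qed

text \<open>\<open>L\<close> is the projection onto the summands with index in \<open>S\<close>.\<close>

lemma direct_sum_projection:
  assumes "is_direct_sum K U"
  shows "\<exists>L. clinear L \<and> (\<forall>k\<in>K. \<forall>a\<in>U k. L a = (if k \<in> S then a else 0))"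
proof -
  define dec where "dec a c \<longleftrightarrow> (\<forall>k\<in>K. c k \<in> U k) \<and> (\<forall>k. k \<notin> K \<longrightarrow> c k = 0) \<and>
      finite {k. c k \<noteq> 0} \<and> a = (\<Sum>k | c k \<noteq> 0. c k)" for a c
  have sub: "k \<in> K \<Longrightarrow> cvec.subspace (U k)" for k
    using assms by (simp add: is_direct_sum_def)
  have ex1: "\<exists>!c. dec a c" for a
    using assms by (simp add: is_direct_sum_def dec_def)
  define coord where "coord a = (THE c. dec a c)" for a
  have dec: "dec a (coord a)" for a
    unfolding coord_def by (rule theI'[OF ex1])
  have coord: "coord a = c" if "dec a c" for a c
    using ex1[of a] dec[of a] that by blast
  have decI: "dec a c" if "\<forall>k\<in>K. c k \<in> U k" "\<forall>k. k \<notin> K \<longrightarrow> c k = 0" "finite F"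
      "{k. c k \<noteq> 0} \<subseteq> F" "a = sum c F" for a c F
    using that unfolding dec_def
    by (auto intro: finite_subset sum.mono_neutral_right)
  define L where "L a = (\<Sum>k | coord a k \<noteq> 0. if k \<in> S then coord a k else 0)" for a
  have fin: "finite {k. coord a k \<noteq> 0}" for a using dec[of a] by (simp add: dec_def)
  have L: "L a = (\<Sum>k\<in>F. if k \<in> S then coord a k else 0)"
    if "finite F" "{k. coord a k \<noteq> 0} \<subseteq> F" for a F
    unfolding L_def by (rule sum.mono_neutral_left) (use that in auto)
  have sum: "a = (\<Sum>k\<in>F. coord a k)" if "finite F" "{k. coord a k \<noteq> 0} \<subseteq> F" for a F
  proof -
    have "a = (\<Sum>k | coord a k \<noteq> 0. coord a k)" using dec[of a] by (simp add: dec_def)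
    also have "\<dots> = (\<Sum>k\<in>F. coord a k)" by (rule sum.mono_neutral_left) (use that in auto)
    finally show ?thesis .
  qed
  have add: "coord (a + b) = (\<lambda>k. coord a k + coord b k)" for a b
  proof (rule coord, rule decI)
    let ?F = "{k. coord a k \<noteq> 0} \<union> {k. coord b k \<noteq> 0}"
    show "finite ?F" using fin by simp
    show "a + b = (\<Sum>k\<in>?F. coord a k + coord b k)"
      using sum[of ?F a] sum[of ?F b] fin by (simp add: sum.distrib)
  qed (use dec[of a] dec[of b] sub in \<open>auto simp: dec_def cvec.subspace_def\<close>)
  have scale: "coord (c *\<^sub>C a) = (\<lambda>k. c *\<^sub>C coord a k)" for c a
  proof (rule coord, rule decI)
    let ?F = "{k. coord a k \<noteq> 0}"
    show "finite ?F" by (rule fin)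
    show "c *\<^sub>C a = (\<Sum>k\<in>?F. c *\<^sub>C coord a k)"
      using sum[of ?F a] fin by (simp add: cvec.scale_sum_right[symmetric])
  qed (use dec[of a] sub in \<open>auto simp: dec_def cvec.subspace_def\<close>)
  have "clinear L"
    unfolding clinear_iff
  proof (intro conjI allI)
    fix a b
    let ?F = "{k. coord a k \<noteq> 0} \<union> {k. coord b k \<noteq> 0}"
    have "{k. coord (a + b) k \<noteq> 0} \<subseteq> ?F" by (auto simp: add)
    then show "L (a + b) = L a + L b"
      using fin by (simp add: L[where F = ?F]) (simp add: add sum.distrib[symmetric] if_distrib cong: if_cong sum.cong)
  next
    fix c a
    let ?F = "{k. coord a k \<noteq> 0}"
    have "{k. coord (c *\<^sub>C a) k \<noteq> 0} \<subseteq> ?F" by (auto simp: scale)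
    then show "L (c *\<^sub>C a) = c *\<^sub>C L a"
      using fin by (simp add: L[where F = ?F]) (simp add: scale cvec.scale_sum_right if_distrib cong: if_cong sum.cong)
  qed
  moreover have "L a = (if k \<in> S then a else 0)" if "k \<in> K" "a \<in> U k" for k a
  proof -
    have c: "coord a = (\<lambda>j. if j = k then a else 0)"
      by (rule coord, rule decI[of _ "{k}"])
        (use that sub in \<open>auto simp: cvec.subspace_def\<close>)
    have "{j. coord a j \<noteq> 0} \<subseteq> {k}" by (auto simp: c)
    then show ?thesis
      using L[of "{k}" a] by (simp add: c)
  qed
  ultimately show ?thesis by blast
qed

text \<open>\<open>m\<close> is the sum of the base units \<open>\<^bold>1(r)\<close> with \<open>r \<in> R\<close>.\<close>

definition unit_sum :: "'j set \<Rightarrow> ('j \<Rightarrow> 'j \<Rightarrow> 'a::complex_algebra set) \<Rightarrow> 'j set \<Rightarrow> 'a multiplier \<Rightarrow> bool"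
  where "unit_sum J C R m \<longleftrightarrow> (\<forall>p\<in>J. \<forall>q\<in>J. \<forall>a\<in>C p q.
    m \<rhd> a = (if p \<in> R then a else 0) \<and> a \<lhd> m = (if q \<in> R then a else 0))"

lemma partial_algebra_induct:
  assumes "partial_algebra J C" and "P 0"
    and "\<And>p q a. p \<in> J \<Longrightarrow> q \<in> J \<Longrightarrow> a \<in> C p q \<Longrightarrow> P a"
    and "\<And>a b. P a \<Longrightarrow> P b \<Longrightarrow> P (a + b)"
  shows "P a"
proof (rule component_induct[of "J \<times> J" "\<lambda>(r, s). C r s" P])
  show "is_direct_sum (J \<times> J) (\<lambda>(r, s). C r s)" using assms(1) by (simp add: partial_algebra_def)
qed (use assms(2-4) in auto)

lemma ex_unit_sum:
  assumes "partial_algebra J C"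
  shows "\<exists>m. unit_sum J C R m"
proof -
  have ds: "is_direct_sum (J \<times> J) (\<lambda>(r, s). C r s)" using assms by (simp add: partial_algebra_def)
  have mult0: "p \<in> J \<Longrightarrow> q \<in> J \<Longrightarrow> q' \<in> J \<Longrightarrow> u \<in> J \<Longrightarrow> q \<noteq> q' \<Longrightarrow> a \<in> C p q \<Longrightarrow> b \<in> C q' u \<Longrightarrow> a * b = 0"
    for p q q' u a b using assms unfolding partial_algebra_def by blast
  obtain L where L: "clinear L" "\<And>p q a. p \<in> J \<Longrightarrow> q \<in> J \<Longrightarrow> a \<in> C p q \<Longrightarrow> L a = (if p \<in> R then a else 0)"
    using direct_sum_projection[OF ds, of "R \<times> UNIV"] by auto
  obtain M where M: "clinear M" "\<And>p q a. p \<in> J \<Longrightarrow> q \<in> J \<Longrightarrow> a \<in> C p q \<Longrightarrow> M a = (if q \<in> R then a else 0)"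
    using direct_sum_projection[OF ds, of "UNIV \<times> R"] by auto
  have "a * L b = M a * b" for a b
  proof (induction a rule: partial_algebra_induct[OF assms])
    case (2 p q a)
    show ?case
    proof (induction b rule: partial_algebra_induct[OF assms])
      case (2 p' q' b)
      then show ?case
        using \<open>p \<in> J\<close> \<open>q \<in> J\<close> \<open>a \<in> C p q\<close> L(2)[of p' q' b] M(2)[of p q a]
          mult0[of p q p' q' a b] by (cases "q = p'") auto
    qed (simp_all add: clinear_zero[OF L(1)] clinear_add[OF L(1)] distrib_left)
  qed (simp_all add: clinear_zero[OF M(1)] clinear_add[OF M(1)] distrib_right)
  then have "unit_sum J C R (multiplier L M)"
    using L M by (simp add: unit_sum_def multiplier_act)
  then show ?thesis by blast
qed

lemma unit_sum_unique:
  assumes "partial_algebra J C" "unit_sum J C R m" "unit_sum J C R n"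
  shows "m = n"
proof (rule multiplier_eqI)
  show "m \<rhd> a = n \<rhd> a" for a
    by (induction a rule: partial_algebra_induct[OF assms(1)])
      (use assms(2,3) in \<open>auto simp: unit_sum_def act_add\<close>)
  show "a \<lhd> m = a \<lhd> n" for a
    by (induction a rule: partial_algebra_induct[OF assms(1)])
      (use assms(2,3) in \<open>auto simp: unit_sum_def act_add\<close>)
qed

lemma unit_sum_base_unit:
  assumes "partial_algebra J C"
  shows "unit_sum J C {r} (base_unit J C r)"
proof -
  have eq: "unit_sum J C {r} m \<longleftrightarrow> (\<forall>r'\<in>J. \<forall>s'\<in>J. \<forall>a\<in>C r' s'.
    m \<rhd> a = (if r = r' then a else 0) \<and> a \<lhd> m = (if r = s' then a else 0))" for m
    by (simp add: unit_sum_def eq_commute)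
  have "\<exists>!m. unit_sum J C {r} m"
    using ex_unit_sum[OF assms] unit_sum_unique[OF assms] by blast
  then have "unit_sum J C {r} (THE m. unit_sum J C {r} m)"
    by (rule theI')
  then show ?thesis unfolding base_unit_def eq .
qed

lemma strict_sum_eq:
  assumes "strict_tendsto (sum f) m (finite_subsets_at_top S)"
  shows "strict_sum S f = m"
  unfolding strict_sum_def
proof (rule the_equality)
  show "strict_tendsto (sum f) m (finite_subsets_at_top S)" by (rule assms)
next
  fix n assume n: "strict_tendsto (sum f) n (finite_subsets_at_top S)"
  have "n \<rhd> a = m \<rhd> a \<and> a \<lhd> n = a \<lhd> m" for a
  proof -
    have "eventually (\<lambda>F. n \<rhd> a = m \<rhd> a \<and> a \<lhd> n = a \<lhd> m) (finite_subsets_at_top S)"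
      using n[unfolded strict_tendsto_def, rule_format, of a]
        assms[unfolded strict_tendsto_def, rule_format, of a]
      by eventually_elim auto
    then show ?thesis by (simp add: eventually_const_iff)
  qed
  then show "n = m" by (intro multiplier_eqI) auto
qed

lemma strict_sum_single:
  assumes "r \<in> S" "\<And>s. s \<in> S \<Longrightarrow> s \<noteq> r \<Longrightarrow> f s = 0"
  shows "strict_sum S f = f r"
proof (rule strict_sum_eq)
  have "eventually (\<lambda>F. sum f F = f r) (finite_subsets_at_top S)"
    unfolding eventually_finite_subsets_at_top
  proof (intro exI[of _ "{r}"] conjI allI impI)
    fix F assume F: "finite F \<and> {r} \<subseteq> F \<and> F \<subseteq> S"
    then have "sum f F = sum f {r}"
      by (intro sum.mono_neutral_right) (use assms(2) in auto)
    then show "sum f F = f r" by simp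
  qed (use assms(1) in auto)
  then show "strict_tendsto (sum f) (f r) (finite_subsets_at_top S)"
    unfolding strict_tendsto_def by (auto elim: eventually_mono)
qed

text \<open>For \<open>g = Pair r\<close> and \<open>g = (\<lambda>r. (r, t))\<close> this computes the units \<open>\<^bold>1\<^sup>r\<close> and \<open>\<^bold>1\<^sub>t\<close>.\<close>

lemma unit_sum_strict_sum:
  assumes pa: "partial_algebra J C" and J: "\<And>x. g x \<in> J \<Longrightarrow> x \<in> I" and g: "inj g"
  shows "unit_sum J C (range g) (strict_sum I (\<lambda>x. base_unit J C (g x)))"
proof -
  let ?f = "\<lambda>x. base_unit J C (g x)"
  obtain m where m: "unit_sum J C (range g) m" using ex_unit_sum[OF pa] by blast
  have "strict_tendsto (sum ?f) m (finite_subsets_at_top I)"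
    unfolding strict_tendsto_def
  proof
    fix a
    show "eventually (\<lambda>F. sum ?f F \<rhd> a = m \<rhd> a \<and> a \<lhd> sum ?f F = a \<lhd> m) (finite_subsets_at_top I)"
    proof (induction a rule: partial_algebra_induct[OF pa])
      case (2 p q a)
      have base: "?f x \<rhd> a = (if g x = p then a else 0)" "a \<lhd> ?f x = (if g x = q then a else 0)" for x
        using unit_sum_base_unit[OF pa, of "g x"] 2 unfolding unit_sum_def by auto
      show ?case
        unfolding eventually_finite_subsets_at_top
      proof (intro exI[of _ "{x. g x = p \<or> g x = q}"] conjI allI impI)
        have "{x. g x = p \<or> g x = q} = g -` {p} \<union> g -` {q}" by auto
        then show "finite {x. g x = p \<or> g x = q}" using g by (simp add: finite_vimageI)
        show "{x. g x = p \<or> g x = q} \<subseteq> I" using J 2 by auto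
        fix F assume F: "finite F \<and> {x. g x = p \<or> g x = q} \<subseteq> F \<and> F \<subseteq> I"
        have sum: "(\<Sum>x\<in>F. if g x = p' then a else 0) = (if p' \<in> range g then a else 0)"
          if "p' = p \<or> p' = q" for p'
        proof (cases "p' \<in> range g")
          case True
          then obtain x where x: "p' = g x" by blast
          then have "g y = p' \<longleftrightarrow> y = x" for y using g by (auto dest: injD)
          moreover have "x \<in> F" using F x that by auto
          ultimately show ?thesis using F True by simp
        next
          case False
          then have "g y \<noteq> p'" for y by auto
          then show ?thesis using False by simp
        qed
        show "sum ?f F \<rhd> a = m \<rhd> a" "a \<lhd> sum ?f F = a \<lhd> m"
          unfolding sum_act base using sum m 2 by (auto simp: unit_sum_def)
      qed
    next
      case (3 a b)
      then show ?case by eventually_elim (simp add: act_add)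
    qed simp
  qed
  then show ?thesis using m by (simp add: strict_sum_eq)
qed

lemma unit_sum_unit_up:
  assumes "partial_algebra (I \<times> I) C"
  shows "unit_sum (I \<times> I) C ({r} \<times> UNIV) (unit_up I C r)"
proof -
  have range: "range (Pair r) = {r} \<times> UNIV" by auto
  have "inj (Pair r)" by (simp add: inj_on_def)
  then have "unit_sum (I \<times> I) C (range (Pair r)) (unit_up I C r)"
    unfolding unit_up_def by (intro unit_sum_strict_sum[OF assms]) auto
  then show ?thesis unfolding range .
qed

lemma unit_sum_unit_low:
  assumes "partial_algebra (I \<times> I) C"
  shows "unit_sum (I \<times> I) C (UNIV \<times> {t}) (unit_low I C t)"
proof -
  have range: "range (\<lambda>r. (r, t)) = UNIV \<times> {t}" by auto
  have "inj (\<lambda>r. (r, t))" by (simp add: inj_on_def)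
  then have "unit_sum (I \<times> I) C (range (\<lambda>r. (r, t))) (unit_low I C t)"
    unfolding unit_low_def by (intro unit_sum_strict_sum[OF assms]) auto
  then show ?thesis unfolding range .
qed


section \<open>Slices of the comultiplication\<close>

text \<open>A partial multiplier Hopf \<open>*\<close>-algebra with a chosen positive faithful left invariant functional.\<close>

locale partial_star_quantum_group =
  fixes I :: "'i set" and C :: "('i, 'a::complex_star_algebra) components"
    and \<Delta> :: "'a \<Rightarrow> ('a, 'a) tensor multiplier" and \<phi> :: "'a \<Rightarrow> complex"
  assumes Hopf: "partial_multiplier_Hopf_star_algebra I C \<Delta>"
    and pos: "positive_functional \<phi>" and faith: "faithful_functional \<phi>"
    and inv: "left_invariant I C \<Delta> \<phi>"
begin

lemma Hopf_algebra: "regular_partial_multiplier_Hopf_algebra I C \<Delta>"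
  and star_components: "\<forall>p\<in>I \<times> I. \<forall>q\<in>I \<times> I. star ` C p q = C q p"
  and comult_star_all: "\<forall>a. \<Delta> (star a) = star (\<Delta> a)"
  using Hopf unfolding partial_multiplier_Hopf_star_algebra_def by - (elim conjE; assumption)+

lemma bialgebra: "regular_partial_multiplier_bialgebra I C \<Delta>"
  using Hopf_algebra unfolding regular_partial_multiplier_Hopf_algebra_def by (rule conjunct1)

lemma canonical_bij:
  "bij_betw (tensor_lift (\<lambda>a b. (embed a \<otimes>\<^sub>m 1) * mflip (\<Delta> b)))
    (tensor_sum I (right_low I C) (left_low I C))
    (embed ` tensor_sum I (right_up I C) (right_low I C))"
  using Hopf_algebra unfolding regular_partial_multiplier_Hopf_algebra_def by (elim conjE)

lemma regular: "regular_comultiplication I C \<Delta>"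
  and ex_counit: "\<exists>\<epsilon>. counit I C \<Delta> \<epsilon>"
  and nondegenerate_partial: "nondegenerate_partial_algebra (I \<times> I) C"
  using bialgebra unfolding regular_partial_multiplier_bialgebra_def by - (elim conjE; assumption)+

lemma partial: "partial_algebra (I \<times> I) C"
  using nondegenerate_partial unfolding nondegenerate_partial_algebra_def by (rule conjunct1)

lemma comult_morphism: "partial_morphism (I \<times> I) C (tensor_unit I C) (tensor_components I C) \<Delta>"
  and comult_regular: "\<forall>a b. \<Delta> a * (embed b \<otimes>\<^sub>m 1) \<in> range embed \<and>
      \<Delta> a * (1 \<otimes>\<^sub>m embed b) \<in> range embed \<and>
      (embed b \<otimes>\<^sub>m 1) * \<Delta> a \<in> range embed \<and> (1 \<otimes>\<^sub>m embed b) * \<Delta> a \<in> range embed"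
  using regular unfolding regular_comultiplication_def by - (elim conjE; assumption)+

lemma comult_linear: "clinear \<Delta>"
  using comult_morphism unfolding partial_morphism_def by (rule conjunct1)

lemma comult_mult: "\<Delta> (a * b) = \<Delta> a * \<Delta> b"
proof -
  have "\<forall>a b. \<Delta> (a * b) = \<Delta> a * \<Delta> b"
    using comult_morphism unfolding partial_morphism_def by (elim conjE)
  then show ?thesis by (elim allE)
qed

lemma comult_star: "\<Delta> (star a) = star (\<Delta> a)"
  using comult_star_all by (rule spec)

lemma component_mult:
  assumes "p \<in> I \<times> I" "q \<in> I \<times> I" "u \<in> I \<times> I" "a \<in> C p q" "b \<in> C q u"
  shows "a * b \<in> C p u"
proof -
  have "\<forall>r\<in>I \<times> I. \<forall>s\<in>I \<times> I. \<forall>t\<in>I \<times> I. \<forall>a\<in>C r s. \<forall>b\<in>C s t. a * b \<in> C r t"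
    using partial unfolding partial_algebra_def by (elim conjE)
  then show ?thesis using assms by blast
qed

lemma star_component: "p \<in> I \<times> I \<Longrightarrow> q \<in> I \<times> I \<Longrightarrow> a \<in> C p q \<Longrightarrow> star a \<in> C q p"
  using star_components by blast

lemma linear_\<phi>: "clinear \<phi>"
  using inv unfolding left_invariant_def by (rule conjunct1)

lemma mslice_right_\<phi>:
  "mslice_right \<phi> (\<Delta> a) = strict_sum I (\<lambda>r. \<phi> (unit_up I C r \<rhd> a) *\<^sub>C unit_up I C r)"
proof -
  have "\<forall>a. mslice_right \<phi> (\<Delta> a) = strict_sum I (\<lambda>r. \<phi> (unit_up I C r \<rhd> a) *\<^sub>C unit_up I C r)"
    using inv unfolding left_invariant_def by (elim conjE)
  then show ?thesis by (rule spec)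
qed

lemma linear_mult_\<phi>: "clinear (\<lambda>b. \<phi> (a * b))"
  using linear_\<phi> by (simp add: clinear_iff distrib_left mult_scaleC_right)

text \<open>The inner product on \<open>A\<close> given by \<open>\<phi>\<close>.\<close>

definition ip\<phi> :: "'a \<Rightarrow> 'a \<Rightarrow> complex"
  where "ip\<phi> a b = \<phi> (star a * b)"

lemma pre_hilbert_ip\<phi>: "pre_hilbert ip\<phi>"
  using pre_hilbert_faithful_positive[OF linear_\<phi> pos faith] by (simp add: ip\<phi>_def[abs_def])

lemma nondegenerate:
  fixes a :: 'a
  shows "(\<And>b. a * b = 0) \<Longrightarrow> a = 0" and "(\<And>b. b * a = 0) \<Longrightarrow> a = 0"
proof -
  have *: "(\<forall>b. \<phi> (a * b) = 0) \<or> (\<forall>b. \<phi> (b * a) = 0) \<longrightarrow> a = 0"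
    using faith unfolding faithful_functional_def by (rule spec)
  show "a = 0" if "\<And>b. a * b = 0" by (rule *[THEN mp]) (simp add: that clinear_zero[OF linear_\<phi>])
  show "a = 0" if "\<And>b. b * a = 0" by (rule *[THEN mp]) (simp add: that clinear_zero[OF linear_\<phi>])
qed

lemma nondegenerate_tensor_square:
  fixes s :: "('a, 'a) tensor"
  shows "(\<And>t. s * t = 0) \<Longrightarrow> s = 0" and "(\<And>t. t * s = 0) \<Longrightarrow> s = 0"
proof -
  have H: "pre_hilbert (\<lambda>a b. \<phi> (star a * b))"
    by (rule pre_hilbert_faithful_positive[OF linear_\<phi> pos faith])
  show "s = 0" if "\<And>t. s * t = 0" by (rule nondegenerate_tensor(1)[OF linear_\<phi> H that])
  show "s = 0" if "\<And>t. t * s = 0" by (rule nondegenerate_tensor(2)[OF linear_\<phi> H that])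
qed

lemma embed_tensor_inj: "embed s = embed t \<longleftrightarrow> s = (t :: ('a, 'a) tensor)"
proof
  assume "embed s = embed t"
  then have "(s - t) * x = 0" for x
    using embed_act(1)[of s x] embed_act(1)[of t x] by (simp add: left_diff_distrib)
  then show "s = t" using nondegenerate_tensor_square(1)[of "s - t"] by simp
qed simp

lemma embed_act_tensor:
  "embed (m \<rhd> t) = m * embed (t :: ('a, 'a) tensor)" "embed (t \<lhd> m) = embed t * m"
proof -
  note l = lact_mult_right[OF nondegenerate_tensor_square(2)]
    and r = ract_mult_left[OF nondegenerate_tensor_square(1)]
  show "embed (m \<rhd> t) = m * embed t"
    by (rule multiplier_eqI) (simp_all add: l multiplier_compat)
  show "embed (t \<lhd> m) = embed t * m"
    by (rule multiplier_eqI) (simp_all add: r multiplier_compat)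
qed

text \<open>\<open>comult_left b a\<close> is \<open>\<Delta>(b)(a \<otimes> 1)\<close>, an element of \<open>A \<otimes> A\<close>.\<close>

definition comult_left :: "'a \<Rightarrow> 'a \<Rightarrow> ('a, 'a) tensor"
  where "comult_left b a = inv embed (\<Delta> b * (embed a \<otimes>\<^sub>m 1))"

lemma embed_comult_left: "embed (comult_left b a) = \<Delta> b * (embed a \<otimes>\<^sub>m 1)"
  unfolding comult_left_def
  by (rule f_inv_into_f) (simp only: comult_regular)

lemma comult_left_add: "comult_left b (a + a') = comult_left b a + comult_left b a'"
  by (simp add: embed_tensor_inj[symmetric] embed_comult_left embed_add mtens_add distrib_left)

lemma comult_left_scaleC: "comult_left b (c *\<^sub>C a) = c *\<^sub>C comult_left b a"
  by (simp add: embed_tensor_inj[symmetric] embed_comult_left embed_scaleC mtens_scaleC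
      mult_scaleC_right)

lemma mslice_right_act:
  assumes "clinear \<omega>"
  shows "mslice_right \<omega> (\<Delta> b) \<rhd> a = slice_right \<omega> (comult_left b a)"
proof -
  define R where "R a = inv embed ((embed a \<otimes>\<^sub>m 1) * \<Delta> b)" for a
  have R: "embed (R a) = (embed a \<otimes>\<^sub>m 1) * \<Delta> b" for a
    unfolding R_def by (rule f_inv_into_f) (simp only: comult_regular)
  have R_add: "R (a + a') = R a + R a'" for a a'
    by (simp add: embed_tensor_inj[symmetric] R embed_add mtens_add distrib_right)
  have R_scale: "R (c *\<^sub>C a) = c *\<^sub>C R a" for c a
    by (simp add: embed_tensor_inj[symmetric] R embed_scaleC mtens_scaleC mult_scaleC_left)
  note lin = clinear_slice_right[OF assms]
  have "(embed a \<otimes>\<^sub>m 1) \<rhd> comult_left b a' = R a \<lhd> (embed a' \<otimes>\<^sub>m 1)" for a a'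
    by (simp add: embed_tensor_inj[symmetric] embed_act_tensor embed_comult_left R mult.assoc)
  then have compat: "a * slice_right \<omega> (comult_left b a') = slice_right \<omega> (R a) * a'" for a a'
    by (simp flip: slice_right_mtens_act(1,2)[OF assms])
  show ?thesis
    unfolding mslice_right_def comult_left_def[symmetric] R_def[symmetric]
  proof (rule multiplier_act)
    show "clinear (\<lambda>a. slice_right \<omega> (comult_left b a))" "clinear (\<lambda>a. slice_right \<omega> (R a))"
      by (intro clinear_comp[OF lin]; simp add: clinear_iff comult_left_add comult_left_scaleC R_add R_scale)+
  qed (rule compat)
qed

text \<open>For homogeneous \<open>b\<close> with right upper index \<open>r\<close>, left invariance reads
  \<open>(id \<otimes> \<phi>)(\<Delta>(b\<^sup>*b)) = \<phi>(b\<^sup>*b)\<^bold>1\<^sup>r\<close>.\<close>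

lemma mslice_right_star_mult:
  assumes "p \<in> I \<times> I" "r \<in> I" "u \<in> I" "b \<in> C p (r, u)"
  shows "mslice_right \<phi> (\<Delta> (star b * b)) = \<phi> (star b * b) *\<^sub>C unit_up I C r"
proof -
  have "star b * b \<in> C (r, u) (r, u)"
    using assms by (intro component_mult[of _ p] star_component) auto
  then have act: "unit_up I C s \<rhd> (star b * b) = (if s = r then star b * b else 0)" for s
    using unit_sum_unit_up[OF partial, of s] assms unfolding unit_sum_def by auto
  have "mslice_right \<phi> (\<Delta> (star b * b)) =
      strict_sum I (\<lambda>s. \<phi> (unit_up I C s \<rhd> (star b * b)) *\<^sub>C unit_up I C s)"
    by (rule mslice_right_\<phi>)
  also have "\<dots> = \<phi> (unit_up I C r \<rhd> (star b * b)) *\<^sub>C unit_up I C r"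
    by (rule strict_sum_single) (use assms clinear_zero[OF linear_\<phi>] in \<open>simp_all add: act\<close>)
  finally show ?thesis by (simp add: act)
qed

lemma slice_star_comult_left:
  assumes "p \<in> I \<times> I" "r \<in> I" "u \<in> I" "b \<in> C p (r, u)"
  shows "slice_right \<phi> (star (comult_left b a) * comult_left b a') =
    \<phi> (star b * b) *\<^sub>C (star a * (unit_up I C r \<rhd> a'))"
proof -
  have "star (comult_left b a) * comult_left b a' = (embed (star a) \<otimes>\<^sub>m 1) \<rhd> comult_left (star b * b) a'"
    by (simp add: embed_tensor_inj[symmetric] embed_mult embed_star embed_act_tensor
        embed_comult_left comult_mult comult_star star_mult star_mtens star_one_multiplier mult.assoc)
  then have "slice_right \<phi> (star (comult_left b a) * comult_left b a') =
      star a * (mslice_right \<phi> (\<Delta> (star b * b)) \<rhd> a')"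
    by (simp add: slice_right_mtens_act[OF linear_\<phi>] mslice_right_act[OF linear_\<phi>])
  then show ?thesis
    by (simp add: mslice_right_star_mult[OF assms] mult_scaleC_right)
qed

lemma unit_up_act_star: "star (unit_up I C r \<rhd> a) = star a \<lhd> unit_up I C r"
proof (induction a rule: partial_algebra_induct[OF partial])
  case (2 p q a)
  then show ?case
    using unit_sum_unit_up[OF partial, of r] star_component[of p q a]
    unfolding unit_sum_def by (auto simp: star_zero)
qed (simp_all add: star_zero star_add act_add)

lemma unit_up_idem: "unit_up I C r \<rhd> unit_up I C r \<rhd> a = unit_up I C r \<rhd> a"
proof (induction a rule: partial_algebra_induct[OF partial])
  case (2 p q a)
  then show ?case
    using unit_sum_unit_up[OF partial, of r] unfolding unit_sum_def by auto
qed (simp_all add: act_add)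

lemma star_unit_up_mult: "star (unit_up I C r \<rhd> a) * (unit_up I C r \<rhd> b) = star a * (unit_up I C r \<rhd> b)"
  by (simp add: unit_up_act_star unit_up_idem flip: multiplier_compat)

text \<open>The functional \<open>\<phi>\<close> is nonzero on each \<open>A\<^sup>r\<close>: the counit is nonzero on some component
  with right indices \<open>r, r\<close>, which therefore has a nonzero element, and \<open>\<phi>\<close> is faithful.\<close>

lemma \<phi>_nonzero:
  assumes "r \<in> I"
  shows "\<exists>x\<in>right_up I C r. \<phi> x \<noteq> 0"
proof -
  obtain \<epsilon> where \<epsilon>: "counit I C \<Delta> \<epsilon>"
    using ex_counit by blast
  have lin: "clinear \<epsilon>"
    and off_diagonal: "\<forall>r\<in>I. \<forall>t\<in>I. \<forall>s\<in>I. \<forall>u\<in>I. r \<noteq> t \<or> s \<noteq> u \<longrightarrow> (\<forall>a\<in>C (r, t) (s, u). \<epsilon> a = 0)"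
    and nonzero: "\<forall>r\<in>I. (\<exists>a\<in>right_low I C r. \<epsilon> a \<noteq> 0) \<and> (\<exists>a\<in>left_low I C r. \<epsilon> a \<noteq> 0)"
    using \<epsilon> unfolding counit_def by - (elim conjE; assumption)+
  obtain a where a: "\<epsilon> (a \<lhd> unit_low I C r) \<noteq> 0"
    using nonzero assms unfolding right_low_def by blast
  have off: "s = t" "u = v" if "s \<in> I" "t \<in> I" "u \<in> I" "v \<in> I" "y \<in> C (s, t) (u, v)" "\<epsilon> y \<noteq> 0"
    for s t u v y
    using off_diagonal that by blast+
  have ex: "\<epsilon> (a \<lhd> unit_low I C r) \<noteq> 0 \<longrightarrow> (\<exists>p\<in>I \<times> I. \<exists>y\<in>C p (r, r). y \<noteq> 0)"
  proof (induction a rule: partial_algebra_induct[OF partial])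
    case (2 p q a)
    obtain s t u v where pq: "p = (s, t)" "q = (u, v)" by fastforce
    show ?case
    proof
      assume nz: "\<epsilon> (a \<lhd> unit_low I C r) \<noteq> 0"
      have "a \<lhd> unit_low I C r = (if v = r then a else 0)"
        using unit_sum_unit_low[OF partial, of r] 2 unfolding unit_sum_def pq by auto
      with nz have "v = r" "\<epsilon> a \<noteq> 0" using clinear_zero[OF lin] by (auto split: if_splits)
      then have "u = r" using off[of s t u v a] 2 pq by auto
      moreover have "a \<noteq> 0" using \<open>\<epsilon> a \<noteq> 0\<close> clinear_zero[OF lin] by auto
      ultimately show "\<exists>p\<in>I \<times> I. \<exists>y\<in>C p (r, r). y \<noteq> 0"
        using 2 pq \<open>v = r\<close> by blast
    qed
  next
    case (3 a b)
    then show ?case by (auto simp: act_add clinear_add[OF lin])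
  qed (simp add: clinear_zero[OF lin])
  then obtain p y where y: "p \<in> I \<times> I" "y \<in> C p (r, r)" "y \<noteq> 0"
    using a by blast
  obtain b where b: "\<phi> (b * y) \<noteq> 0"
    using faith y(3) unfolding faithful_functional_def by blast
  have "y \<lhd> unit_up I C r = y"
    using unit_sum_unit_up[OF partial, of r] y assms unfolding unit_sum_def by auto
  then have "b * y = (b * y) \<lhd> unit_up I C r"
    by (simp add: ract_mult_left[OF nondegenerate(1)])
  then show ?thesis using b unfolding right_up_def by blast
qed

lemma ex_embed_mult_comult: "\<exists>d. embed d = (1 \<otimes>\<^sub>m embed a) * \<Delta> b"
proof -
  have "(1 \<otimes>\<^sub>m embed a) * \<Delta> b \<in> range embed"
    by (simp only: comult_regular)
  then show ?thesis by force
qed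

text \<open>The slices \<open>(id \<otimes> \<phi>)((1 \<otimes> a)\<Delta>(b))\<close> span \<open>A\<close>, because of the bijectivity of the
  canonical map \<open>a \<otimes> b \<mapsto> (a \<otimes> 1)\<Delta>\<^sup>o\<^sup>p(b)\<close>.\<close>

lemma slices_span:
  assumes S: "cvec.subspace S"
    and slice: "\<And>a b p q d. p \<in> I \<times> I \<Longrightarrow> q \<in> I \<times> I \<Longrightarrow> b \<in> C p q \<Longrightarrow>
      embed d = (1 \<otimes>\<^sub>m embed a) * \<Delta> b \<Longrightarrow> slice_right \<phi> d \<in> S"
  shows "S = UNIV"
proof -
  let ?can = "tensor_lift (\<lambda>a b. (embed a \<otimes>\<^sub>m 1) * mflip (\<Delta> b))"
  note lin = clinear_slice_right[OF linear_\<phi>]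
  have zero: "0 \<in> S" and S_add: "x \<in> S \<Longrightarrow> y \<in> S \<Longrightarrow> x + y \<in> S" and scale: "x \<in> S \<Longrightarrow> c *\<^sub>C x \<in> S"
    for x y c using S by (auto simp: cvec.subspace_def)
  have slice': "\<forall>d. embed d = (1 \<otimes>\<^sub>m embed a) * \<Delta> b \<longrightarrow> slice_right \<phi> d \<in> S" for a b
  proof (induction b rule: partial_algebra_induct[OF partial])
    case 1
    show ?case
    proof (intro allI impI)
      fix d assume "embed d = (1 \<otimes>\<^sub>m embed a) * \<Delta> 0"
      also have "\<dots> = embed 0"
        by (rule multiplier_eqI) (simp_all add: clinear_zero[OF comult_linear])
      finally have "d = 0" by (simp only: embed_tensor_inj)
      then show "slice_right \<phi> d \<in> S" using zero by (simp add: clinear_zero[OF lin])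
    qed
  next
    case (2 p q b)
    then show ?case using slice by blast
  next
    case (3 b b')
    show ?case
    proof (intro allI impI)
      fix d assume d: "embed d = (1 \<otimes>\<^sub>m embed a) * \<Delta> (b + b')"
      obtain e e' where e: "embed e = (1 \<otimes>\<^sub>m embed a) * \<Delta> b" "embed e' = (1 \<otimes>\<^sub>m embed a) * \<Delta> b'"
        using ex_embed_mult_comult by metis
      then have "d = e + e'"
        using d by (simp add: clinear_add[OF comult_linear] distrib_left
            embed_tensor_inj[symmetric] embed_add)
      then show "slice_right \<phi> d \<in> S"
        using 3 e by (simp add: clinear_add[OF lin] S_add)
    qed
  qed
  have bil: "bilinear_map (\<lambda>a b. (embed a \<otimes>\<^sub>m 1) * mflip (\<Delta> b))"
    by (simp add: semi_bilinear_def clinear_add[OF comult_linear] clinear_scaleC[OF comult_linear]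
        embed_add embed_scaleC mtens_add mtens_scaleC mflip_add mflip_scaleC
        distrib_left distrib_right mult_scaleC_left mult_scaleC_right)
  have can: "\<exists>d. embed d = mflip (?can t) \<and> slice_right \<phi> d \<in> S" for t
  proof (induction t)
    case (tens a b)
    have "mflip (?can (a \<otimes>\<^sub>t b)) = (1 \<otimes>\<^sub>m embed a) * \<Delta> b"
      by (simp add: bil mflip_mult mflip_mtens mflip_mflip)
    then show ?case using ex_embed_mult_comult slice' by metis
  next
    case (add s t)
    then obtain d e where "embed d = mflip (?can s)" "slice_right \<phi> d \<in> S"
      "embed e = mflip (?can t)" "slice_right \<phi> e \<in> S" by blast
    then have "embed (d + e) = mflip (?can (s + t)) \<and> slice_right \<phi> (d + e) \<in> S"
      by (simp add: tensor_semilift_add[OF bil] mflip_add embed_add clinear_add[OF lin] S_add)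
    then show ?case by blast
  qed
  have "y \<in> S" for y
  proof (induction y rule: partial_algebra_induct[OF partial])
    case (2 p q y)
    obtain s r where q: "q = (s, r)" "s \<in> I" "r \<in> I" using 2 by blast
    have "y \<lhd> unit_low I C r = y"
      using unit_sum_unit_low[OF partial, of r] 2 q unfolding unit_sum_def by auto
    then have y: "y \<in> right_low I C r" unfolding right_low_def by (metis (mono_tags, lifting) mem_Collect_eq)
    obtain x where x: "x \<in> right_up I C r" "\<phi> x \<noteq> 0" using \<phi>_nonzero[OF q(3)] by blast
    have "x \<otimes>\<^sub>t y \<in> tensor_sum I (right_up I C) (right_low I C)"
      unfolding tensor_sum_def by (rule cvec.span_base) (use x y q in blast)
    then have "embed (x \<otimes>\<^sub>t y) \<in> ?can ` tensor_sum I (right_low I C) (left_low I C)"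
      unfolding bij_betw_imp_surj_on[OF canonical_bij] by (rule imageI)
    then obtain t where t: "embed (x \<otimes>\<^sub>t y) = ?can t" by (rule imageE)
    obtain d where d: "embed d = mflip (?can t)" "slice_right \<phi> d \<in> S" using can by blast
    have "embed d = embed (y \<otimes>\<^sub>t x)"
      unfolding d(1) t[symmetric] by (simp add: embed_tens mflip_mtens)
    then have "\<phi> x *\<^sub>C y \<in> S"
      using d(2) by (simp add: embed_tensor_inj slice_right_tens[OF linear_\<phi>])
    then have "(1 / \<phi> x) *\<^sub>C \<phi> x *\<^sub>C y \<in> S" by (rule scale)
    then show ?case using x(2) by (simp add: scaleC_scaleC scaleC_one)
  qed (simp_all add: zero S_add)
  then show ?thesis by blast
qed

end

section \<open>Boundedness of the action on a unitary module\<close>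

lemma Re_of_real_mult: "Re (complex_of_real x * z) = x * Re z"
  by simp

locale partial_star_quantum_group_module = partial_star_quantum_group I C \<Delta> \<phi>
  for I :: "'i set" and C :: "('i, 'a::complex_star_algebra) components" and \<Delta> \<phi> +
  fixes act :: "'a \<Rightarrow> 'v::complex_vector \<Rightarrow> 'v" and ip :: "'v \<Rightarrow> 'v \<Rightarrow> complex"
  assumes mod: "unitary_module act ip"
begin

lemma module: "left_module act" and span_act: "cvec.span {act a v | a v. True} = UNIV"
  and pre_hilbert_ip: "pre_hilbert ip"
  and ip_act_all: "\<forall>a v w. ip v (act a w) = ip (act (star a) v) w"
  using mod unfolding unitary_module_def by - (elim conjE; assumption)+

lemma bilinear_act: "bilinear_map act" and act_mult_all: "\<forall>a b v. act (a * b) v = act a (act b v)"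
  using module unfolding left_module_def by - (elim conjE; assumption)+

lemma act_mult: "act (a * b) v = act a (act b v)"
  using act_mult_all by (elim allE)

lemma ip_act: "ip v (act a w) = ip (act (star a) v) w"
  using ip_act_all by (elim allE)

lemma act_simps:
  "act (a + b) v = act a v + act b v" "act a (v + w) = act a v + act a w"
  "act (c *\<^sub>C a) v = c *\<^sub>C act a v" "act a (c *\<^sub>C v) = c *\<^sub>C act a v"
  using bilinear_act by (simp_all add: semi_bilinear_def)

lemma linear_act: "clinear (act a)" "clinear (\<lambda>a. act a v)"
  by (simp_all add: clinear_iff act_simps)

text \<open>The action \<open>A \<otimes> V \<rightarrow> V\<close>, which is surjective because \<open>AV = V\<close>.\<close>

definition action :: "('a, 'v) tensor \<Rightarrow> 'v"
  where "action = tensor_lift act"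

lemma action_tens [simp]: "action (a \<otimes>\<^sub>t v) = act a v"
  by (simp add: action_def bilinear_act)

lemma linear_action: "clinear action"
  by (simp add: action_def bilinear_act clinear_tensor_lift)

lemma action_surj: "\<exists>t. v = action t"
proof -
  have "v \<in> cvec.span {act a v | a v. True}"
    by (simp only: span_act UNIV_I)
  moreover have "cvec.subspace (range action)"
    unfolding cvec.subspace_def
  proof (intro conjI ballI allI)
    show "0 \<in> range action" using clinear_zero[OF linear_action] by (metis rangeI)
    show "x + y \<in> range action" if "x \<in> range action" "y \<in> range action" for x y
      using that by (auto simp flip: clinear_add[OF linear_action])
    show "c *\<^sub>C x \<in> range action" if "x \<in> range action" for c x
      using that by (auto simp flip: clinear_scaleC[OF linear_action])
  qed
  moreover have "{act a v | a v. True} \<subseteq> range action"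
    by (auto simp flip: action_tens)
  ultimately have "v \<in> range action" using cvec.span_minimal by blast
  then show ?thesis by blast
qed

text \<open>\<open>act_left s v\<close> applies the first leg of \<open>s \<in> A \<otimes> A\<close> to \<open>v\<close>.\<close>

definition act_left :: "('a, 'a) tensor \<Rightarrow> 'v \<Rightarrow> ('v, 'a) tensor"
  where "act_left s v = tensor_map (\<lambda>a. act a v) (\<lambda>b. b) s"

lemma act_left_tens: "act_left (a \<otimes>\<^sub>t b) v = act a v \<otimes>\<^sub>t b"
  by (simp add: act_left_def linear_act clinear_ident)

lemma act_left_linear: "clinear (\<lambda>s. act_left s v)"
  unfolding act_left_def by (intro clinear_tensor_map linear_act clinear_ident)

lemma act_left_add: "act_left s (v + w) = act_left s v + act_left s w"
  by (induction s) (simp_all add: act_left_tens act_simps tens_add_left clinear_add[OF act_left_linear])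

lemma act_left_scaleC: "act_left s (c *\<^sub>C v) = c *\<^sub>C act_left s v"
  by (induction s)
    (simp_all add: act_left_tens act_simps tens_scaleC_left clinear_add[OF act_left_linear] scaleC_add_right)

lemma tensor_form_act_left:
  "tensor_form ip ip\<phi> (act_left s v) (act_left t w) = ip v (act (slice_right \<phi> (star s * t)) w)"
proof -
  note simps = act_left_tens clinear_add[OF act_left_linear] tensor_form_tens[OF pre_hilbert_ip pre_hilbert_ip\<phi>]
    tensor_form_add_left[OF pre_hilbert_ip pre_hilbert_ip\<phi>]
    clinear_add[OF tensor_form_linear_right[OF pre_hilbert_ip pre_hilbert_ip\<phi>]]
    clinear_add[OF clinear_slice_right[OF linear_\<phi>]] slice_right_tens[OF linear_\<phi>]
    star_tens star_add distrib_left distrib_right act_simps pre_hilbertD(1,2)[OF pre_hilbert_ip]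
  show ?thesis
  proof (induction s)
    case (tens a b)
    show ?case
      by (induction t)
        (simp_all add: simps act_mult ip_act[of v "star a"] star_star, simp add: ip\<phi>_def)
  qed (simp add: simps)
qed

lemma slice_act_left: 
  assumes "clinear \<omega>"
  shows "slice_right \<omega> (act_left s v) = act (slice_right \<omega> s) v"
  by (induction s) (simp_all add: act_left_tens slice_right_tens[OF assms] act_simps
      clinear_add[OF act_left_linear] clinear_add[OF clinear_slice_right[OF assms]])

text \<open>The map \<open>A \<otimes> V \<rightarrow> V \<otimes> A\<close>, \<open>a \<otimes> v \<mapsto> \<Delta>(b)(a \<otimes> 1)(v \<otimes> -)\<close>. It is defined on \<open>A \<otimes> V\<close>
  rather than on \<open>V = AV\<close>, which avoids showing that it factors through the action.\<close>

definition can_map :: "'a \<Rightarrow> ('a, 'v) tensor \<Rightarrow> ('v, 'a) tensor"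
  where "can_map b = tensor_lift (\<lambda>a v. act_left (comult_left b a) v)"

lemma bilinear_can_map: "bilinear_map (\<lambda>a v. act_left (comult_left b a) v)"
  by (simp add: semi_bilinear_def act_left_add act_left_scaleC comult_left_add comult_left_scaleC
      clinear_add[OF act_left_linear] clinear_scaleC[OF act_left_linear])

lemma can_map_tens: "can_map b (a \<otimes>\<^sub>t v) = act_left (comult_left b a) v"
  by (simp add: can_map_def bilinear_can_map)

lemma linear_can_map: "clinear (can_map b)"
  by (simp add: can_map_def bilinear_can_map clinear_tensor_lift)

text \<open>\<open>unit_act r t\<close> is \<open>\<^bold>1\<^sup>r\<close> applied to the vector \<open>action t\<close>, represented on \<open>A \<otimes> V\<close> for the same
  reason.\<close>

definition unit_act :: "'i \<Rightarrow> ('a, 'v) tensor \<Rightarrow> 'v"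
  where "unit_act r t = action (tensor_map (lact (unit_up I C r)) (\<lambda>v. v) t)"

lemma unit_act_tens: "unit_act r (a \<otimes>\<^sub>t v) = act (unit_up I C r \<rhd> a) v"
  by (simp add: unit_act_def clinear_lact clinear_ident)

lemma linear_unit_act: "clinear (unit_act r)"
  unfolding unit_act_def[abs_def]
  by (intro clinear_comp[OF linear_action] clinear_tensor_map clinear_lact clinear_ident)

text \<open>The isometry property: the left-hand side reduces to \<open>(id \<otimes> \<phi>)(\<Delta>(b\<^sup>*b))\<close>.\<close>

lemma tensor_form_can_map:
  assumes "p \<in> I \<times> I" "r \<in> I" "u \<in> I" "b \<in> C p (r, u)"
  shows "tensor_form ip ip\<phi> (can_map b s) (can_map b t) =
    \<phi> (star b * b) * ip (unit_act r s) (unit_act r t)"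
proof -
  note simps = can_map_tens clinear_add[OF linear_can_map] unit_act_tens
    tensor_form_add_left[OF pre_hilbert_ip pre_hilbert_ip\<phi>]
    clinear_add[OF tensor_form_linear_right[OF pre_hilbert_ip pre_hilbert_ip\<phi>]]
    tensor_form_act_left slice_star_comult_left[OF assms] act_simps clinear_add[OF linear_unit_act]
    pre_hilbertD(1-3)[OF pre_hilbert_ip] distrib_left
  show ?thesis
  proof (induction s)
    case (tens a v)
    show ?case
    proof (induction t)
      case (tens a' w)
      have "ip (act (unit_up I C r \<rhd> a) v) (act (unit_up I C r \<rhd> a') w) =
          ip v (act (star (unit_up I C r \<rhd> a) * (unit_up I C r \<rhd> a')) w)"
        by (simp add: act_mult ip_act[of v] star_star)
      then show ?case by (simp add: simps star_unit_up_mult)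
    qed (simp add: simps)
  qed (simp add: simps)
qed

text \<open>\<open>\<^bold>1\<^sup>r\<close> is an orthogonal projection.\<close>

lemma unit_act_contraction:
  "Re (ip (unit_act r t) (unit_act r t)) \<le> Re (ip (action t) (action t))"
proof -
  have eq: "ip (unit_act r s) (unit_act r t) = ip (unit_act r s) (action t)" for s t
  proof (induction s)
    case (tens a v)
    show ?case
    proof (induction t)
      case (tens a' w)
      have "ip (act (unit_up I C r \<rhd> a) v) (act x w) = ip v (act (star (unit_up I C r \<rhd> a) * x) w)" for x
        unfolding act_mult ip_act[of v "star (unit_up I C r \<rhd> a)"] star_star ..
      moreover have "star (unit_up I C r \<rhd> a) * (unit_up I C r \<rhd> a') = star (unit_up I C r \<rhd> a) * a'"
        unfolding star_unit_up_mult unfolding unit_up_act_star multiplier_compat ..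
      ultimately show ?case by (simp add: unit_act_tens)
    qed (simp add: clinear_add[OF linear_unit_act] clinear_add[OF linear_action]
        pre_hilbertD(1)[OF pre_hilbert_ip])
  qed (simp add: clinear_add[OF linear_unit_act] pre_hilbertD(3)[OF pre_hilbert_ip])
  let ?p = "unit_act r t" and ?v = "action t"
  have "ip ?v ?p = ip ?p ?p"
    using eq[of t t] pre_hilbertD(5)[OF pre_hilbert_ip, of ?p ?v]
      pre_hilbertD(5)[OF pre_hilbert_ip, of ?p ?p] by simp
  then have "ip (?v - ?p) (?v - ?p) = ip ?v ?v - ip ?p ?p"
    using eq[of t t] by (simp add: pre_hilbert_diff[OF pre_hilbert_ip])
  then show ?thesis using pre_hilbertD(7)[OF pre_hilbert_ip, of "?v - ?p"] by simp
qed

text \<open>With \<open>x = (id \<otimes> \<phi>)((1 \<otimes> a)\<Delta>(b))\<close>, the vector \<open>x(a'v)\<close> is the slice of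
  \<open>\<Delta>(b)(a' \<otimes> 1)(v \<otimes> -)\<close> by the functional \<open>\<langle>a\<^sup>*, -\<rangle>\<close>.\<close>

lemma slice_act_bounded:
  assumes b: "p \<in> I \<times> I" "q \<in> I \<times> I" "b \<in> C p q"
    and d: "embed d = (1 \<otimes>\<^sub>m embed a) * \<Delta> b"
  shows "\<exists>K\<ge>0. \<forall>v. Re (ip (act (slice_right \<phi> d) v) (act (slice_right \<phi> d) v)) \<le> K * Re (ip v v)"
proof -
  obtain r u where q: "q = (r, u)" "r \<in> I" "u \<in> I" using b(2) by blast
  define c where "c = star a"
  have \<omega>: "ip\<phi> c = (\<lambda>x. \<phi> (a * x))" by (rule ext) (simp add: ip\<phi>_def c_def star_star)
  have lin: "clinear (ip\<phi> c)" unfolding \<omega> by (rule linear_mult_\<phi>)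
  have slice: "act (slice_right \<phi> d) (action t) = slice_right (ip\<phi> c) (can_map b t)" for t
  proof (induction t)
    case (tens a' v)
    have "d \<lhd> (embed a' \<otimes>\<^sub>m 1) = (1 \<otimes>\<^sub>m embed a) \<rhd> comult_left b a'"
      by (simp add: embed_tensor_inj[symmetric] embed_act_tensor embed_comult_left d mult.assoc)
    then have "slice_right \<phi> d * a' = slice_right (ip\<phi> c) (comult_left b a')"
      unfolding \<omega> by (metis slice_right_mtens_act(2,3)[OF linear_\<phi>])
    then show ?case
      by (simp add: can_map_tens slice_act_left[OF lin] flip: act_mult)
  qed (simp add: clinear_add[OF linear_action] act_simps clinear_add[OF linear_can_map]
      clinear_add[OF clinear_slice_right[OF lin]])
  let ?n = "Re (\<phi> (star b * b))" and ?m = "Re (ip\<phi> c c)"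
  have n: "\<phi> (star b * b) = complex_of_real ?n" "?n \<ge> 0" and m: "?m \<ge> 0"
    using pre_hilbertD(6,7)[OF pre_hilbert_ip\<phi>, of b] pre_hilbertD(7)[OF pre_hilbert_ip\<phi>, of c]
    unfolding ip\<phi>_def by blast+
  have "Re (ip (act (slice_right \<phi> d) v) (act (slice_right \<phi> d) v)) \<le> (?m * ?n) * Re (ip v v)" for v
  proof -
    obtain t where t: "v = action t" using action_surj by blast
    have "Re (ip (act (slice_right \<phi> d) v) (act (slice_right \<phi> d) v)) \<le>
        ?m * Re (tensor_form ip ip\<phi> (can_map b t) (can_map b t))"
      unfolding t slice by (rule slice_bounded[OF pre_hilbert_ip pre_hilbert_ip\<phi>])
    also have "Re (tensor_form ip ip\<phi> (can_map b t) (can_map b t)) =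
        ?n * Re (ip (unit_act r t) (unit_act r t))"
      unfolding tensor_form_can_map[OF b(1) q(2,3) b(3)[unfolded q(1)]]
      by (subst n(1)) (rule Re_of_real_mult)
    also have "?m * (?n * Re (ip (unit_act r t) (unit_act r t))) \<le> ?m * (?n * Re (ip v v))"
      unfolding t by (intro mult_left_mono unit_act_contraction n(2) m)
    finally show ?thesis by (simp add: mult.assoc)
  qed
  then show ?thesis using m n(2) by (intro exI[of _ "?m * ?n"]) simp
qed

lemma ip_norm_bound_iff: "0 \<le> K \<Longrightarrow> ip_norm ip v \<le> K * ip_norm ip w \<longleftrightarrow> Re (ip v v) \<le> K\<^sup>2 * Re (ip w w)"
proof -
  assume "0 \<le> K"
  then have "K * ip_norm ip w = sqrt (K\<^sup>2 * Re (ip w w))"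
    by (simp add: ip_norm_def real_sqrt_mult)
  then show ?thesis by (simp add: ip_norm_def)
qed

lemma ip_norm_triangle: "ip_norm ip (v + w) \<le> ip_norm ip v + ip_norm ip w"
proof -
  note H = pre_hilbert_ip
  have nn: "0 \<le> ip_norm ip x" "(ip_norm ip x)\<^sup>2 = Re (ip x x)" for x
    using pre_hilbertD(7)[OF H, of x] by (simp_all add: ip_norm_def)
  have "(cmod (ip v w))\<^sup>2 \<le> (ip_norm ip v * ip_norm ip w)\<^sup>2"
    using pre_hilbert_Cauchy_Schwarz[OF H, of v w] by (simp add: power_mult_distrib nn)
  then have "cmod (ip v w) \<le> ip_norm ip v * ip_norm ip w"
    by (rule power2_le_imp_le) (simp add: nn)
  then have CS: "Re (ip v w) \<le> ip_norm ip v * ip_norm ip w"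
    using complex_Re_le_cmod order_trans by blast
  have "Re (ip w v) = Re (ip v w)"
    by (simp flip: pre_hilbertD(5)[OF H, of v w])
  then have "Re (ip (v + w) (v + w)) = Re (ip v v) + 2 * Re (ip v w) + Re (ip w w)"
    by (simp add: pre_hilbertD(1,3)[OF H])
  then have "(ip_norm ip (v + w))\<^sup>2 \<le> (ip_norm ip v + ip_norm ip w)\<^sup>2"
    using CS by (simp add: nn power2_sum)
  then show ?thesis by (rule power2_le_imp_le) (simp add: nn)
qed

theorem act_bounded: "bounded_operator ip (act a)"
proof -
  let ?bd = "\<lambda>a. \<exists>K\<ge>0. \<forall>v. ip_norm ip (act a v) \<le> K * ip_norm ip v"
  have "{a. ?bd a} = UNIV"
  proof (rule slices_span)
    show "cvec.subspace {a. ?bd a}"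
      unfolding cvec.subspace_def
    proof (intro conjI ballI allI)
      have "act 0 v = 0" for v by (rule clinear_zero[OF linear_act(2)])
      then show "0 \<in> {a. ?bd a}"
        by (auto intro!: exI[of _ 0] simp: ip_norm_def pre_hilbert_zero[OF pre_hilbert_ip])
    next
      fix x y assume "x \<in> {a. ?bd a}" "y \<in> {a. ?bd a}"
      then obtain K L where K: "K \<ge> 0" "\<And>v. ip_norm ip (act x v) \<le> K * ip_norm ip v"
        and L: "L \<ge> 0" "\<And>v. ip_norm ip (act y v) \<le> L * ip_norm ip v" by auto
      have "ip_norm ip (act (x + y) v) \<le> (K + L) * ip_norm ip v" for v
        using ip_norm_triangle[of "act x v" "act y v"] K(2)[of v] L(2)[of v]
        by (simp add: act_simps distrib_right)
      then show "x + y \<in> {a. ?bd a}" using K(1) L(1) by (auto intro!: exI[of _ "K + L"])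
    next
      fix c x assume "x \<in> {a. ?bd a}"
      then obtain K where K: "K \<ge> 0" "\<And>v. ip_norm ip (act x v) \<le> K * ip_norm ip v" by auto
      have "ip_norm ip (act (c *\<^sub>C x) v) \<le> (cmod c * K) * ip_norm ip v" for v
      proof -
        let ?w = "act x v"
        have "ip (c *\<^sub>C ?w) (c *\<^sub>C ?w) = (c * cnj c) * ip ?w ?w"
          by (simp add: pre_hilbertD(2,4)[OF pre_hilbert_ip])
        also have "c * cnj c = complex_of_real ((cmod c)\<^sup>2)" by (simp only: complex_norm_square)
        finally have "Re (ip (c *\<^sub>C ?w) (c *\<^sub>C ?w)) = (cmod c)\<^sup>2 * Re (ip ?w ?w)"
          by (simp only: Re_of_real_mult)
        then have "ip_norm ip (c *\<^sub>C ?w) \<le> cmod c * ip_norm ip ?w"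
          by (simp add: ip_norm_bound_iff)
        also have "\<dots> \<le> cmod c * (K * ip_norm ip v)" using K(2) by (intro mult_left_mono) auto
        finally show ?thesis by (simp add: act_simps mult.assoc)
      qed
      then show "c *\<^sub>C x \<in> {a. ?bd a}" using K(1) by (auto intro!: exI[of _ "cmod c * K"])
    qed
  next
    fix a b d and p q :: "'i \<times> 'i"
    assume "p \<in> I \<times> I" "q \<in> I \<times> I" "b \<in> C p q" "embed d = (1 \<otimes>\<^sub>m embed a) * \<Delta> b"
    then obtain K where K: "K \<ge> 0"
      "\<And>v. Re (ip (act (slice_right \<phi> d) v) (act (slice_right \<phi> d) v)) \<le> K * Re (ip v v)"
      using slice_act_bounded by blast
    then show "slice_right \<phi> d \<in> {a. ?bd a}"
      by (auto intro!: exI[of _ "sqrt K"] simp: ip_norm_bound_iff)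
  qed
  then have "?bd a" by blast
  then show ?thesis
    using linear_act(1) by (auto simp: bounded_operator_def)
qed

end

theorem proposition2p30:
  fixes I :: "'i set"
    and C :: "('i, 'a::complex_star_algebra) components"
    and \<Delta> :: "'a \<Rightarrow> ('a, 'a) tensor multiplier"
    and act :: "'a \<Rightarrow> 'v::complex_vector \<Rightarrow> 'v"
    and ip :: "'v \<Rightarrow> 'v \<Rightarrow> complex"
  assumes "partial_star_algebraic_quantum_group I C \<Delta>"
    and "unitary_module act ip"
  shows "\<forall>a. bounded_operator ip (act a)"
proof -
  obtain \<phi> where "positive_functional \<phi>" "faithful_functional \<phi>" "left_invariant I C \<Delta> \<phi>"
    and "partial_multiplier_Hopf_star_algebra I C \<Delta>"
    using assms(1) unfolding partial_star_algebraic_quantum_group_def by blast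
  then interpret partial_star_quantum_group_module I C \<Delta> \<phi> act ip
    using assms(2) by unfold_locales
  show ?thesis using act_bounded by blast
qed

end
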